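(* There exist numerical constants $C_1>0$ and $C$ (a positive integer) such that the following holds. Let $\rho$ be a probability measure on $\mathbb{T}$, let $n\ge 2$ be an integer, and let $\Omega$ be a real number. (A) Suppose that $e_n(\rho)\le e^{-\Omega}$. Then there are $p\le n$ closed arcs $I_1,\dots,I_p$ on $\mathbb{T}$ such that $$\operatorname{cap}\Bigl(\bigcup_{1\le\ell\le p}I_\ell\Bigr)\le e^{-\frac12\frac{\Omega}{n}}\qquad\text{and}\qquad \rho\Bigl(\mathbb{T}\setminus\bigcup_{1\le\ell\le p}I_\ell\Bigr)\le e^{-\Omega}.$$ (B) Suppose that there are $p\le n$ closed arcs $I_1,\dots,I_p$ on $\mathbb{T}$ such that $$\operatorname{cap}\Bigl(\bigcup_{1\le\ell\le p}I_\ell\Bigr)\le e^{-\frac{\Omega}{n}}\qquad\text{and}\qquad \rho\Bigl(\mathbb{T}\setminus\bigcup_{1\le\ell\le p}I_\ell\Bigr)\le e^{-\Omega}$$ with $\Omega\ge C_1 n$. Then $e_{Cn}(\rho)\le e^{-\Omega/4}$.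
   Context: $\mathbb{T}$ is the unit circle; $\operatorname{cap}$ denotes the logarithmic capacity (normalized so that a disk of radius $r$ has capacity $r$); the whole circle and single points are allowed as (degenerate) closed arcs. For a finite positive Borel measure $\rho$ on $\mathbb{T}$ and an integer $n\ge 0$, $e_n(\rho)\ge 0$ is defined by $$e_n(\rho)^2=\min_{q_0,\dots,q_{n-1}\in\mathbb{C}}\int_{\mathbb{T}}\bigl|t^n+q_{n-1}t^{n-1}+\dots+q_1t+q_0\bigr|^2\,d\rho(t).$$ *)

theory Defs
  imports "HOL-Probability.Probability"
begin

text \<open>Closed arcs of the unit circle, including single points (\<open>a = b\<close>) and the whole circle
  (\<open>b = a + 2 * pi\<close>).\<close>

definition closed_arc :: "complex set \<Rightarrow> bool" where
  "closed_arc I \<longleftrightarrow> (\<exists>a b. a \<le> b \<and> b \<le> a + 2 * pi \<and> I = cis ` {a..b})"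

text \<open>The diagonal is treated separately because \<open>ln 0 = 0\<close> in HOL.\<close>

definition log_kernel :: "complex \<Rightarrow> complex \<Rightarrow> ereal" where
  "log_kernel z w = (if z = w then \<infinity> else ereal (- ln (dist z w)))"

text \<open>The integral of \<open>log_kernel\<close>, split into positive and negative part (\<open>e2ennreal\<close> sends
  negative values to 0). The negative part is finite for measures of bounded support.\<close>

definition log_energy :: "complex measure \<Rightarrow> ereal" where
  "log_energy \<mu> =
     enn2ereal (\<integral>\<^sup>+z. \<integral>\<^sup>+w. e2ennreal (log_kernel z w) \<partial>\<mu> \<partial>\<mu>)
     - enn2ereal (\<integral>\<^sup>+z. \<integral>\<^sup>+w. e2ennreal (- log_kernel z w) \<partial>\<mu> \<partial>\<mu>)"

text \<open>The Robin constant of a compact set \<open>K\<close>; it is \<open>\<infinity>\<close> if \<open>K\<close> carries no measure of finite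
  energy, in particular if \<open>K\<close> is empty.\<close>

definition robin_const :: "complex set \<Rightarrow> ereal" where
  "robin_const K =
     (INF \<mu> \<in> {\<mu>. prob_space \<mu> \<and> sets \<mu> = sets borel \<and> emeasure \<mu> K = 1}. log_energy \<mu>)"

definition log_capacity :: "complex set \<Rightarrow> real" where
  "log_capacity K =
     (if robin_const K = \<infinity> then 0 else exp (- real_of_ereal (robin_const K)))"

text \<open>The infimum is attained: it is the squared \<open>L\<^sup>2\<close>-distance from \<open>t ^ n\<close> to a
  finite-dimensional subspace.\<close>

definition poly_dist :: "complex measure \<Rightarrow> nat \<Rightarrow> real" where
  "poly_dist \<rho> n =
     sqrt (INF q :: nat \<Rightarrow> complex. \<integral>t. (cmod (t ^ n + (\<Sum>k<n. q k * t ^ k)))\<^sup>2 \<partial>\<rho>)"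

end

theory Submission
  imports Defs "HOL-Real_Asymp.Real_Asymp"
begin

text \<open>(A) The extremal polynomial \<open>P\<close> satisfies \<open>\<bar>P\<bar> \<le> exp (- \<Omega> / 2)\<close> on the circle up to a set of
  measure \<open>exp (- \<Omega>)\<close>, by Markov's inequality. This sublevel set has at most \<open>n\<close> components because
  \<open>\<bar>P\<bar>\<^sup>2\<close> is a trigonometric polynomial of degree \<open>n\<close>. For its capacity, \<open>N\<close> points picked
  from a measure of energy \<open>e\<close> have pair energy at most about \<open>N\<^sup>2 e\<close>, while Lagrange
  interpolation of the monic polynomials \<open>z ^ (k mod n) * P z ^ (k div n)\<close> bounds the pair energy
  of any \<open>N\<close> points of the sublevel set from below.

  (B) If no monic polynomial of degree less than \<open>6 n\<close> with zeros in the union \<open>E\<close> of the arcs is small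
  on \<open>E\<close>, then greedily chosen points give a set of \<open>6 n\<close> points of \<open>E\<close> with small pair energy. All but
  at most \<open>n + 1\<close> of the gaps between neighbouring points lie in \<open>E\<close>, and spreading mass uniformly
  over these gaps yields a measure on \<open>E\<close> whose energy contradicts the bound on the capacity. The
  comparison of kernel values on gaps with those at the points rests on the concavity of the
  chord length \<open>2 sin (u / 2)\<close> on \<open>[0, 2 pi]\<close>.\<close>

section \<open>Shifted logarithmic energy\<close>

text \<open>Chords of the unit circle have length at most 2, so adding \<open>ln 2\<close> to the
  logarithmic kernel makes it nonnegative there, and its energy becomes one \<open>ennreal\<close>
  integral without cancellation.\<close>

definition shifted_kernel :: "complex \<Rightarrow> complex \<Rightarrow> ennreal" where
  "shifted_kernel z w = (if z = w then \<infinity> else ennreal (ln (2 / dist z w)))"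

lemma shifted_kernel_commute: "shifted_kernel z w = shifted_kernel w z"
  by (simp add: shifted_kernel_def dist_commute)

lemma measurable_shifted_kernel [measurable]:
  "case_prod shifted_kernel \<in> borel_measurable (borel \<Otimes>\<^sub>M borel)"
  unfolding shifted_kernel_def split_beta by measurable

lemma measurable_log_kernel [measurable]:
  "case_prod log_kernel \<in> borel_measurable (borel \<Otimes>\<^sub>M borel)"
  unfolding log_kernel_def split_beta by measurable

lemma dist_sphere_le: "z \<in> sphere 0 1 \<Longrightarrow> w \<in> sphere 0 1 \<Longrightarrow> dist z w \<le> 2" for z w :: complex
  using dist_triangle[of z w 0] by (simp add: dist_commute)

text \<open>Free of subtraction, so that it can be integrated in \<open>ennreal\<close>; on the
  diagonal both sides are infinite. The bound 2 on the distance keeps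
  \<open>ln (2 / dist z w)\<close> from being truncated at 0.\<close>

lemma kernel_split:
  assumes "dist z w \<le> 2"
  shows "e2ennreal (log_kernel z w) + ennreal (ln 2) = shifted_kernel z w + e2ennreal (- log_kernel z w)"
proof (cases "z = w")
  case False
  then have d: "dist z w > 0" by simp
  have e: "e2ennreal (ereal x) = ennreal (max 0 x)" for x
    by (metis e2ennreal_ereal ennreal_max_0 ennreal_max_0')
  have l: "ln (2 / dist z w) = ln 2 - ln (dist z w)" using d by (simp add: ln_div)
  have "ln (dist z w) \<le> ln 2" using d assms by simp
  then show ?thesis using False
    by (cases "dist z w \<le> 1")
      (simp_all add: log_kernel_def shifted_kernel_def e l ennreal_neg d add.commute flip: ennreal_plus)
next
  case True
  then show ?thesis
    by (simp add: log_kernel_def shifted_kernel_def e2ennreal_infty top_add e2ennreal_neg)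
qed

text \<open>Integrate \<open>kernel_split\<close> twice. The negative part \<open>N\<close> is at
  most \<open>ln 2\<close>, hence finite, and may be cancelled in the extended reals.\<close>

lemma log_energy_eq:
  assumes "prob_space \<mu>" and s: "sets \<mu> = sets borel" and ae: "AE z in \<mu>. z \<in> sphere 0 1"
  shows "log_energy \<mu> = enn2ereal (\<integral>\<^sup>+z. \<integral>\<^sup>+w. shifted_kernel z w \<partial>\<mu> \<partial>\<mu>) - ereal (ln 2)"
proof -
  interpret prob_space \<mu> by fact
  note [measurable_cong] = s
  define P where "P = (\<integral>\<^sup>+z. \<integral>\<^sup>+w. e2ennreal (log_kernel z w) \<partial>\<mu> \<partial>\<mu>)"
  define N where "N = (\<integral>\<^sup>+z. \<integral>\<^sup>+w. e2ennreal (- log_kernel z w) \<partial>\<mu> \<partial>\<mu>)"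
  define K where "K = (\<integral>\<^sup>+z. \<integral>\<^sup>+w. shifted_kernel z w \<partial>\<mu> \<partial>\<mu>)"
  have "P + ennreal (ln 2) = (\<integral>\<^sup>+z. \<integral>\<^sup>+w. (e2ennreal (log_kernel z w) + ennreal (ln 2)) \<partial>\<mu> \<partial>\<mu>)"
    unfolding P_def by (subst nn_integral_add, measurable)+ (simp add: emeasure_space_1)
  also have "\<dots> = (\<integral>\<^sup>+z. \<integral>\<^sup>+w. (shifted_kernel z w + e2ennreal (- log_kernel z w)) \<partial>\<mu> \<partial>\<mu>)"
  proof (intro nn_integral_cong_AE, use ae in eventually_elim, intro nn_integral_cong_AE, use ae in eventually_elim)
    fix z w :: complex assume "z \<in> sphere 0 1" "w \<in> sphere 0 1"
    then show "e2ennreal (log_kernel z w) + ennreal (ln 2) = shifted_kernel z w + e2ennreal (- log_kernel z w)"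
      by (intro kernel_split dist_sphere_le)
  qed
  also have "\<dots> = K + N"
    unfolding K_def N_def by (subst nn_integral_add, measurable)+
  finally have eq: "P + ennreal (ln 2) = K + N" .
  have "N \<le> (\<integral>\<^sup>+z. \<integral>\<^sup>+w. ennreal (ln 2) \<partial>\<mu> \<partial>\<mu>)"
    unfolding N_def
  proof (intro nn_integral_mono_AE, use ae in eventually_elim, intro nn_integral_mono_AE, use ae in eventually_elim)
    fix z w :: complex assume "z \<in> sphere 0 1" "w \<in> sphere 0 1"
    then have "dist z w \<le> 2" by (intro dist_sphere_le)
    then show "e2ennreal (- log_kernel z w) \<le> ennreal (ln 2)"
      by (cases "z = w") (auto simp: log_kernel_def e2ennreal_neg intro!: ennreal_leI)
  qed
  also have "\<dots> = ennreal (ln 2)" by (simp add: emeasure_space_1)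
  finally have "N < \<infinity>" by (simp add: le_less_trans)
  then obtain r where r: "N = ennreal r" "r \<ge> 0" by (cases N) auto
  have e: "enn2ereal (a + b) = enn2ereal a + enn2ereal b" for a b by (simp add: plus_ennreal.rep_eq)
  have "enn2ereal P + ereal (ln 2) = enn2ereal K + ereal r"
    using arg_cong[OF eq, of enn2ereal] r by (simp add: e enn2ereal_ennreal)
  then have "enn2ereal P - ereal r = enn2ereal K - ereal (ln 2)"
    by (cases "enn2ereal P"; cases "enn2ereal K") auto
  then show ?thesis
    unfolding log_energy_def P_def[symmetric] N_def[symmetric] K_def[symmetric]
    using r by (simp add: enn2ereal_ennreal)
qed

section \<open>Choosing points that do no worse than the average\<close>

lemma (in prob_space) ex_le_nn_integral:
  assumes [measurable]: "f \<in> borel_measurable M" and ae: "AE x in M. P x"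
  shows "\<exists>x\<in>space M. P x \<and> f x \<le> (\<integral>\<^sup>+x. f x \<partial>M)"
proof (rule ccontr)
  define c where "c = (\<integral>\<^sup>+x. f x \<partial>M)"
  assume "\<not> ?thesis"
  then have "P x \<Longrightarrow> x \<in> space M \<Longrightarrow> c < f x" for x by (auto simp: c_def not_le)
  with ae have gt: "AE x in M. c < f x" by auto
  then have "\<exists>x. c < f x" by (metis AE_contr eventually_elim2)
  then have "c \<noteq> \<infinity>" by auto
  have "(\<integral>\<^sup>+x. c \<partial>M) < (\<integral>\<^sup>+x. f x \<partial>M)"
  proof (rule nn_integral_less)
    show "AE x in M. c \<le> f x" using gt by auto
    show "\<not> (AE x in M. f x \<le> c)"
    proof
      assume "AE x in M. f x \<le> c"
      with gt have "AE x in M. False" by eventually_elim auto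
      then show False by simp
    qed
  qed (use \<open>c \<noteq> \<infinity>\<close> in \<open>auto simp: emeasure_space_1\<close>)
  then show False by (simp add: emeasure_space_1 c_def)
qed

lemma choose_two_Suc: "Suc d choose 2 = d + (d choose 2)"
  by (simp add: numeral_2_eq_2)

text \<open>The points are chosen one by one so that the conditional expectation of the sum over pairs,
  given the points chosen so far, does not increase.\<close>

lemma (in prob_space) ex_points_pair_sum_le:
  fixes k :: "'a \<Rightarrow> 'a \<Rightarrow> ennreal"
  assumes [measurable]: "case_prod k \<in> borel_measurable (M \<Otimes>\<^sub>M M)"
    and sym: "\<And>x y. k x y = k y x" and ae: "AE x in M. P x"
  shows "\<exists>z::nat \<Rightarrow> 'a. (\<forall>i<N. P (z i)) \<and>
    (\<Sum>i<N. \<Sum>j<i. k (z i) (z j)) \<le> of_nat (N choose 2) * (\<integral>\<^sup>+x. \<integral>\<^sup>+y. k x y \<partial>M \<partial>M)"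
proof -
  define U where "U = (\<lambda>x. \<integral>\<^sup>+y. k x y \<partial>M)"
  define J where "J = (\<integral>\<^sup>+x. U x \<partial>M)"
  have [measurable]: "U \<in> borel_measurable M" unfolding U_def by measurable
  \<comment> \<open>The left side is the expected pair sum when \<open>r\<close> points are fixed
    and \<open>d\<close> are still drawn independently: fixed pairs, mixed pairs (averaged to
    \<open>U\<close>), random pairs (averaged to \<open>J\<close>). For \<open>r = 0\<close> it
    equals the right side, and \<open>d = 0\<close> is the claim.\<close>
  have "\<exists>z::nat \<Rightarrow> 'a. (\<forall>i<r. P (z i) \<and> z i \<in> space M) \<and>
     (\<Sum>i<r. \<Sum>j<i. k (z i) (z j)) + of_nat d * (\<Sum>i<r. U (z i)) + of_nat (d choose 2) * J
      \<le> of_nat ((r + d) choose 2) * J" for r d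
  proof (induction r arbitrary: d)
    case 0
    then show ?case by simp
  next
    case (Suc r)
    from Suc.IH[of "Suc d"] obtain z where z: "\<And>i. i < r \<Longrightarrow> P (z i)" "\<And>i. i < r \<Longrightarrow> z i \<in> space M"
      and le: "(\<Sum>i<r. \<Sum>j<i. k (z i) (z j)) + of_nat (Suc d) * (\<Sum>i<r. U (z i)) + of_nat (Suc d choose 2) * J
      \<le> of_nat ((r + Suc d) choose 2) * J" by blast
    have [measurable]: "(\<lambda>x. k x (z i)) \<in> borel_measurable M" if "i < r" for i
      using z(2)[OF that] by measurable
    \<comment> \<open>\<open>f x\<close> is what fixing the next point at \<open>x\<close>
      contributes; its mean is the part of the expectation that it replaces.\<close>
    define f where "f x = (\<Sum>i<r. k x (z i)) + of_nat d * U x" for x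
    have fm [measurable]: "f \<in> borel_measurable M" unfolding f_def by measurable
    obtain x where x: "x \<in> space M" "P x" and fx: "f x \<le> (\<integral>\<^sup>+x. f x \<partial>M)"
      using ex_le_nn_integral[OF fm ae] by blast
    have "(\<integral>\<^sup>+x. (\<Sum>i<r. k x (z i)) \<partial>M) = (\<Sum>i<r. U (z i))"
      unfolding U_def by (subst nn_integral_sum) (auto intro!: sum.cong nn_integral_cong simp: sym)
    then have "(\<integral>\<^sup>+x. f x \<partial>M) = (\<Sum>i<r. U (z i)) + of_nat d * J"
      unfolding f_def by (simp add: nn_integral_add nn_integral_cmult J_def)
    with fx have fx: "f x \<le> (\<Sum>i<r. U (z i)) + of_nat d * J" by simp
    let ?z = "z(r := x)"
    have "(\<Sum>i<Suc r. \<Sum>j<i. k (?z i) (?z j)) + of_nat d * (\<Sum>i<Suc r. U (?z i)) + of_nat (d choose 2) * J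
      = (\<Sum>i<r. \<Sum>j<i. k (z i) (z j)) + of_nat d * (\<Sum>i<r. U (z i)) + of_nat (d choose 2) * J + f x"
      by (simp add: f_def algebra_simps)
    also have "\<dots> \<le> (\<Sum>i<r. \<Sum>j<i. k (z i) (z j)) + of_nat d * (\<Sum>i<r. U (z i)) + of_nat (d choose 2) * J
       + ((\<Sum>i<r. U (z i)) + of_nat d * J)"
      by (intro add_left_mono fx)
    also have "\<dots> = (\<Sum>i<r. \<Sum>j<i. k (z i) (z j)) + of_nat (Suc d) * (\<Sum>i<r. U (z i)) + of_nat (Suc d choose 2) * J"
      unfolding choose_two_Suc by (simp add: algebra_simps)
    also note le
    finally show ?case using x z by (intro exI[of _ ?z]) (auto simp: less_Suc_eq)
  qed
  from this[of N 0] show ?thesis by (auto simp: J_def U_def numeral_2_eq_2)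
qed

section \<open>Pair energy of finite point sets\<close>

text \<open>Lagrange interpolation at \<open>degree Q + 1\<close> nodes reproduces \<open>Q\<close>,
  since the difference \<open>R\<close> would have more roots than its degree allows; then compare
  the coefficients at \<open>degree Q\<close>.\<close>

lemma sum_Lagrange_monic:
  fixes Q :: "'a::field poly"
  assumes "finite A" "card A = Suc (degree Q)" "lead_coeff Q = 1"
  shows "(\<Sum>z\<in>A. poly Q z / (\<Prod>w\<in>A-{z}. z - w)) = 1"
proof -
  let ?B = "\<lambda>z. \<Prod>w\<in>A-{z}. [:-w, 1:]"
  let ?c = "\<lambda>z. poly Q z / (\<Prod>w\<in>A-{z}. z - w)"
  define R where "R = Q - (\<Sum>z\<in>A. smult (?c z) (?B z))"
  have degB: "degree (?B z) = degree Q" "coeff (?B z) (degree Q) = 1" if "z \<in> A" for z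
  proof -
    show d: "degree (?B z) = degree Q"
      using assms that by (subst degree_prod_eq_sum_degree) auto
    have "lead_coeff (?B z) = 1" by (simp add: lead_coeff_prod)
    with d show "coeff (?B z) (degree Q) = 1" by simp
  qed
  have Bz: "poly (?B z) x = (if x = z then (\<Prod>w\<in>A-{z}. z - w) else 0)" if "z \<in> A" "x \<in> A" for x z
    using that assms(1) by (auto simp: poly_prod intro!: prod_zero)
  have nz: "(\<Prod>w\<in>A-{z}. z - w) \<noteq> 0" for z using assms(1) by auto
  have "poly R x = 0" if "x \<in> A" for x
  proof -
    have "(\<Sum>z\<in>A. ?c z * poly (?B z) x) = (\<Sum>z\<in>A. if x = z then poly Q x else 0)"
      using that nz by (intro sum.cong) (auto simp: Bz simp del: poly_prod)
    then show ?thesis using that assms(1) by (simp add: R_def poly_sum)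
  qed
  moreover have "degree R \<le> degree Q" unfolding R_def
    using degB by (intro degree_diff_le degree_sum_le assms) (auto intro: order.trans[OF degree_smult_le])
  ultimately have "R = 0"
    using assms(2) card_mono[of "{x. poly R x = 0}" A] poly_roots_finite[of R] card_poly_roots_bound[of R]
    by (metis (mono_tags, lifting) le_trans mem_Collect_eq not_less_eq_eq subsetI)
  then have "coeff (\<Sum>z\<in>A. smult (?c z) (?B z)) (degree Q) = coeff Q (degree Q)"
    by (simp add: R_def)
  then show ?thesis using degB assms(3) by (simp add: coeff_sum)
qed

text \<open>For finite \<open>A\<close> this is \<open>ln 2\<close> per ordered pair minus the
  logarithm of the squared modulus of the Vandermonde determinant. Each chord counts twice.\<close>

definition pair_energy :: "complex set \<Rightarrow> real" where
  "pair_energy A = (\<Sum>z\<in>A. \<Sum>w\<in>A-{z}. ln (2 / dist z w))"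

lemma pair_energy_insert:
  assumes "finite A" "z \<notin> A"
  shows "pair_energy (insert z A) = pair_energy A + 2 * (\<Sum>w\<in>A. ln (2 / dist z w))"
proof -
  have "pair_energy (insert z A) = (\<Sum>w\<in>A. ln (2 / dist z w)) + (\<Sum>w\<in>A. \<Sum>v\<in>insert z A - {w}. ln (2 / dist w v))"
    using assms by (simp add: pair_energy_def)
  also have "(\<Sum>w\<in>A. \<Sum>v\<in>insert z A - {w}. ln (2 / dist w v)) = (\<Sum>w\<in>A. ln (2 / dist z w) + (\<Sum>v\<in>A - {w}. ln (2 / dist w v)))"
  proof (intro sum.cong refl)
    fix w assume "w \<in> A"
    then have "insert z A - {w} = insert z (A - {w})" using assms by auto
    then show "(\<Sum>v\<in>insert z A - {w}. ln (2 / dist w v)) = ln (2 / dist z w) + (\<Sum>v\<in>A - {w}. ln (2 / dist w v))"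
      using assms by (simp add: dist_commute)
  qed
  finally show ?thesis by (simp add: pair_energy_def sum.distrib)
qed

lemma pair_energy_image:
  fixes N :: nat
  shows "inj_on z {..<N} \<Longrightarrow> pair_energy (z ` {..<N}) = 2 * (\<Sum>i<N. \<Sum>j<i. ln (2 / dist (z i) (z j)))"
proof (induction N)
  case (Suc N)
  then have i: "inj_on z {..<N}" and nin: "z N \<notin> z ` {..<N}" by (auto simp: lessThan_Suc)
  have "(\<Sum>w\<in>z ` {..<N}. ln (2 / dist (z N) w)) = (\<Sum>j<N. ln (2 / dist (z N) (z j)))"
    using i by (simp add: sum.reindex)
  then show ?case using Suc.IH[OF i] nin by (simp add: lessThan_Suc pair_energy_insert)
qed (simp add: pair_energy_def)

lemma ln_two_div_dist_nonneg:
  "z \<in> sphere 0 1 \<Longrightarrow> w \<in> sphere 0 1 \<Longrightarrow> 0 \<le> ln (2 / dist z w)" for z w :: complex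
  using dist_sphere_le[of z w] by (cases "z = w") auto

lemma sum_ln_two_div_dist:
  assumes "finite A" "z \<notin> A"
  shows "(\<Sum>w\<in>A. ln (2 / dist z w)) = real (card A) * ln 2 - ln (\<Prod>w\<in>A. dist z w)"
proof -
  have "(\<Sum>w\<in>A. ln (2 / dist z w)) = (\<Sum>w\<in>A. ln 2 - ln (dist z w))"
    using assms by (intro sum.cong refl) (auto simp: ln_div)
  also have "\<dots> = real (card A) * ln 2 - ln (\<Prod>w\<in>A. dist z w)"
    using assms by (subst ln_prod) (auto simp: sum_subtractf)
  finally show ?thesis .
qed

text \<open>Points are removed one by one. In the Lagrange identity for \<open>\<phi> N\<close> at
  \<open>N + 1\<close> points some summand has modulus at least \<open>1 / (N + 1)\<close>, so the
  product of distances from its node to the others is at most \<open>(N + 1) * c N\<close> and that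
  node carries much energy. The factors \<open>N + 1\<close> build up the factorial.\<close>

lemma pair_energy_ge:
  fixes \<phi> :: "nat \<Rightarrow> complex poly" and c :: "nat \<Rightarrow> real"
  assumes \<phi>: "\<And>k. degree (\<phi> k) = k" "\<And>k. lead_coeff (\<phi> k) = 1"
    and le: "\<And>k z. z \<in> E \<Longrightarrow> cmod (poly (\<phi> k) z) \<le> c k" and c: "\<And>k. c k > 0"
    and "finite A" "A \<subseteq> E" "card A = N"
  shows "pair_energy A \<ge> real N * (real N - 1) * ln 2 - 2 * ln (fact N) - 2 * (\<Sum>k<N. ln (c k))"
  using assms(5-)
proof (induction N arbitrary: A)
  case 0
  then show ?case by (simp add: pair_energy_def)
next
  case (Suc N)
  let ?p = "\<lambda>z. \<Prod>w\<in>A-{z}. dist z w"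
  have pos: "?p z > 0" for z using Suc.prems(1) by (auto intro!: prod_pos)
  have "\<exists>z\<in>A. ?p z \<le> Suc N * c N"
  proof (rule ccontr)
    assume "\<not> ?thesis"
    then have gt: "?p z > Suc N * c N" if "z \<in> A" for z using that by auto
    have ne: "A \<noteq> {}" using Suc.prems by auto
    have "1 = cmod (\<Sum>z\<in>A. poly (\<phi> N) z / (\<Prod>w\<in>A-{z}. z - w))"
      using sum_Lagrange_monic[of A "\<phi> N"] \<phi>[of N] Suc.prems by simp
    also have "\<dots> \<le> (\<Sum>z\<in>A. cmod (poly (\<phi> N) z) / ?p z)"
      by (rule sum_norm_le) (simp add: norm_divide dist_norm flip: prod_norm)
    also have "\<dots> < (\<Sum>z\<in>A. 1 / Suc N)"
    proof (rule sum_strict_mono[OF Suc.prems(1) ne])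
      fix z assume z: "z \<in> A"
      have "cmod (poly (\<phi> N) z) * Suc N \<le> Suc N * c N"
        using le[of z N] z Suc.prems by (subst mult.commute) (intro mult_left_mono, auto)
      also have "\<dots> < ?p z" by (rule gt[OF z])
      finally show "cmod (poly (\<phi> N) z) / ?p z < 1 / Suc N"
        using pos[of z] by (simp add: divide_simps)
    qed
    also have "\<dots> = 1" using Suc.prems by simp
    finally show False by simp
  qed
  then obtain z where z: "z \<in> A" and zle: "?p z \<le> Suc N * c N" by auto
  have ins: "insert z (A - {z}) = A" using z by auto
  have "ln (?p z) \<le> ln (Suc N * c N)" using zle pos[of z] by (intro ln_mono) auto
  also have "\<dots> = ln (Suc N) + ln (c N)" using c[of N] by (simp add: ln_mult)
  finally have l: "ln (?p z) \<le> ln (Suc N) + ln (c N)" .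
  have "(\<Sum>w\<in>A-{z}. ln (2 / dist z w)) = real N * ln 2 - ln (?p z)"
    using sum_ln_two_div_dist[of "A - {z}" z] Suc.prems z by simp
  moreover have "real N * (real N - 1) * ln 2 - 2 * ln (fact N) - 2 * (\<Sum>k<N. ln (c k)) \<le> pair_energy (A - {z})"
    using Suc.prems z by (intro Suc.IH) auto
  moreover have "pair_energy A = pair_energy (A - {z}) + 2 * (\<Sum>w\<in>A-{z}. ln (2 / dist z w))"
    using pair_energy_insert[of "A - {z}" z] Suc.prems unfolding ins by auto
  moreover have "ln (fact (Suc N) :: real) = ln (Suc N) + ln (fact N)" 
    by (simp add: ln_mult)
  ultimately show ?case using l by (simp add: algebra_simps)
qed

section \<open>Capacity of lemniscates\<close>

lemma log_capacity_le:
  assumes "\<And>\<mu>. prob_space \<mu> \<Longrightarrow> sets \<mu> = sets borel \<Longrightarrow> emeasure \<mu> K = 1 \<Longrightarrow> ereal r \<le> log_energy \<mu>"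
  shows "log_capacity K \<le> exp (- r)"
proof -
  have "ereal r \<le> robin_const K"
    unfolding robin_const_def by (rule INF_greatest) (use assms in auto)
  then show ?thesis by (cases "robin_const K") (auto simp: log_capacity_def)
qed

text \<open>Positivity of \<open>r\<close> excludes the Robin constant \<open>-\<infinity>\<close>,
  to which \<open>real_of_ereal\<close> assigns 0 and hence \<open>log_capacity\<close> the value
  1.\<close>

lemma log_energy_ge_of_log_capacity_le:
  assumes "log_capacity K \<le> exp (- r)" "r > 0"
    and "prob_space \<mu>" "sets \<mu> = sets borel" "emeasure \<mu> K = 1"
  shows "ereal r \<le> log_energy \<mu>"
proof -
  have "ereal r \<le> robin_const K"
    using assms(1,2) by (cases "robin_const K") (auto simp: log_capacity_def)
  also have "\<dots> \<le> log_energy \<mu>"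
    unfolding robin_const_def by (rule INF_lower) (use assms in auto)
  finally show ?thesis .
qed

lemma ln_fact_le: "ln (fact N) \<le> real N * ln (real N)" 
proof (cases "N = 0")
  case False
  have "ln (fact N :: real) \<le> ln (real N ^ N)"
    using fact_le_power[of N, where ?'a = real] False by (subst ln_le_cancel_iff) auto
  then show ?thesis using False by (simp add: ln_realpow)
qed simp

lemma pair_energy_ge_lemniscate:
  fixes P :: "complex poly"
  assumes P: "degree P = n" "lead_coeff P = 1" "n \<ge> 1" and l: "0 < l" "l \<le> 1"
    and E: "E \<subseteq> sphere 0 1" "\<And>z. z \<in> E \<Longrightarrow> cmod (poly P z) \<le> l"
    and A: "finite A" "A \<subseteq> E" "card A = N" "N \<ge> 2"
  shows "pair_energy A \<ge> real N * ((real N - 1) * (ln 2 - ln l / n) + 2 * ln l - 2 * ln N)"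
proof -
  \<comment> \<open>One monic polynomial of each degree that inherits the smallness of
    \<open>P\<close> on \<open>E\<close>: as many factors \<open>P\<close> as fit, filled up by a
    power of \<open>z\<close>, which has modulus 1 on the circle.\<close>
  define \<phi> where "\<phi> k = P ^ (k div n) * monom 1 (k mod n)" for k
  have P0: "P \<noteq> 0" using P by auto
  have lc: "lead_coeff (\<phi> k) = 1" for k
    unfolding \<phi>_def lead_coeff_mult lead_coeff_power P(2) lead_coeff_monom by simp
  have deg: "degree (\<phi> k) = k" for k
  proof -
    have "degree (\<phi> k) = degree (P ^ (k div n)) + degree (monom (1::complex) (k mod n))"
      unfolding \<phi>_def using P0 by (intro degree_mult_eq) (auto simp: monom_eq_0_iff)
    also have "degree (monom (1::complex) (k mod n)) = k mod n" by (rule degree_monom_eq) simp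
    finally show ?thesis using P P0 by (simp add: degree_power_eq)
  qed
  have le: "cmod (poly (\<phi> k) z) \<le> l ^ (k div n)" if "z \<in> E" for k z
  proof -
    have "cmod z = 1" using E(1) that by auto
    then show ?thesis using E(2)[OF that] by (simp add: \<phi>_def poly_monom norm_mult norm_power power_mono)
  qed
  have "pair_energy A \<ge> real N * (real N - 1) * ln 2 - 2 * ln (fact N) - 2 * (\<Sum>k<N. ln (l ^ (k div n)))"
    by (rule pair_energy_ge[OF deg lc le]) (use l A in auto)
  \<comment> \<open>Since \<open>ln l \<le> 0\<close>, a lower bound on \<open>k div n\<close>
    bounds the logarithm from above. Replacing the integer quotient by \<open>k / n - 1\<close>
    makes the sum explicit at a cost linear in \<open>N\<close>.\<close>
  moreover have "(\<Sum>k<N. ln (l ^ (k div n))) \<le> (\<Sum>k<N. (real k / n - 1) * ln l)"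
  proof (rule sum_mono)
    fix k
    have "real k / n - 1 \<le> real (k div n)"
    proof -
      have "real k \<le> real (n + n * (k div n))"
        using dividend_less_times_div[of n k] P(3) by (subst of_nat_le_iff) linarith
      then show ?thesis using P(3) by (simp add: field_simps)
    qed
    then show "ln (l ^ (k div n)) \<le> (real k / n - 1) * ln l"
      using l by (simp add: ln_realpow mult_right_mono_neg)
  qed
  moreover have "(\<Sum>k<N. (real k / n - 1) * ln l) = (real N * (real N - 1) / 2 / n - N) * ln l"
  proof -
    have "(\<Sum>k<N. real k) = real N * (real N - 1) / 2" by (induction N) (auto simp: field_simps)
    then have "(\<Sum>k<N. real k / n) = real N * (real N - 1) / 2 / n" by (simp only: sum_divide_distrib[symmetric])
    then show ?thesis by (simp add: sum_subtractf flip: sum_distrib_right)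
  qed
  moreover have "ln (fact N) \<le> real N * ln (real N)" by (rule ln_fact_le)
  moreover have "real N * ((real N - 1) * (ln 2 - ln l / n) + 2 * ln l - 2 * ln N) =
      real N * (real N - 1) * ln 2 - 2 * (real N * ln N) - 2 * ((real N * (real N - 1) / 2 / n - N) * ln l)"
    using P(3) by (simp add: field_simps)
  ultimately show ?thesis by linarith
qed

text \<open>\<open>N\<close> points sampled from \<open>\<mu>\<close> have pair energy at most
  \<open>N * (N - 1)\<close> times the shifted energy, while
  \<open>pair_energy_ge_lemniscate\<close> bounds it from below. After division by
  \<open>N * (N - 1)\<close> the correction is of order \<open>ln N / N\<close> and vanishes in the
  limit.\<close>

lemma log_energy_ge_lemniscate:
  fixes P :: "complex poly"
  assumes P: "degree P = n" "lead_coeff P = 1" "n \<ge> 1" and l: "0 < l" "l \<le> 1"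
    and E: "E \<subseteq> sphere 0 1" "\<And>z. z \<in> E \<Longrightarrow> cmod (poly P z) \<le> l"
    and \<mu>: "prob_space \<mu>" "sets \<mu> = sets borel" "emeasure \<mu> E = 1"
  shows "ereal (- ln l / n) \<le> log_energy \<mu>"
proof -
  interpret prob_space \<mu> by fact
  note [measurable_cong] = \<mu>(2)
  have "E \<in> sets \<mu>" using \<mu>(3) emeasure_notin_sets[of E \<mu>] by fastforce
  then have aeE: "AE z in \<mu>. z \<in> E" using \<mu>(3) by (simp add: AE_in_set_eq_1 emeasure_eq_measure)
  then have "AE z in \<mu>. z \<in> sphere 0 1" by eventually_elim (use E(1) in auto)
  note eq = log_energy_eq[OF \<mu>(1,2) this]
  have cm: "case_prod shifted_kernel \<in> borel_measurable (\<mu> \<Otimes>\<^sub>M \<mu>)" by measurable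
  define K where "K = (\<integral>\<^sup>+z. \<integral>\<^sup>+w. shifted_kernel z w \<partial>\<mu> \<partial>\<mu>)"
  show ?thesis
  proof (cases "K = \<infinity>")
    case True
    then show ?thesis by (simp add: eq flip: K_def)
  next
    case False
    then obtain \<kappa> where \<kappa>: "K = ennreal \<kappa>" "\<kappa> \<ge> 0" by (cases K) auto
    have bd: "ln 2 - ln l / n + (2 * ln l - 2 * ln (real N)) / (real N - 1) \<le> \<kappa>" if N: "N \<ge> 2" for N
    proof -
      obtain z where z: "\<And>i. i < N \<Longrightarrow> z i \<in> E"
        and sle: "(\<Sum>i<N. \<Sum>j<i. shifted_kernel (z i) (z j)) \<le> of_nat (N choose 2) * K"
        using ex_points_pair_sum_le[OF cm shifted_kernel_commute aeE] unfolding K_def by blast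
      have fin: "(\<Sum>i<N. \<Sum>j<i. shifted_kernel (z i) (z j)) < \<infinity>"
        using sle by (rule le_less_trans) (simp add: \<kappa> ennreal_mult_less_top of_nat_less_top)
      \<comment> \<open>The kernel is infinite on the diagonal, so a finite sum forces the sampled
        points to be distinct.\<close>
      have ne: "z i \<noteq> z j" if "i < N" "j < i" for i j
      proof
        assume "z i = z j"
        then have "shifted_kernel (z i) (z j) = \<infinity>" by (simp add: shifted_kernel_def)
        with fin that show False by (auto dest!: bspec simp: less_top)
      qed
      then have inj: "inj_on z {..<N}" by (auto simp: inj_on_def) (metis linorder_neqE_nat)
      have nn: "0 \<le> ln (2 / dist (z i) (z j))" if "i < N" "j < i" for i j
        using that by (intro ln_two_div_dist_nonneg subsetD[OF E(1)] z) auto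
      have "(\<Sum>i<N. \<Sum>j<i. shifted_kernel (z i) (z j)) = (\<Sum>i<N. \<Sum>j<i. ennreal (ln (2 / dist (z i) (z j))))"
        using ne by (intro sum.cong refl) (auto simp: shifted_kernel_def)
      also have "\<dots> = (\<Sum>i<N. ennreal (\<Sum>j<i. ln (2 / dist (z i) (z j))))"
        using nn by (intro sum.cong refl sum_ennreal) auto
      also have "\<dots> = ennreal (\<Sum>i<N. \<Sum>j<i. ln (2 / dist (z i) (z j)))"
        using nn by (intro sum_ennreal sum_nonneg) auto
      finally have "ennreal (\<Sum>i<N. \<Sum>j<i. ln (2 / dist (z i) (z j))) \<le> ennreal (real (N choose 2) * \<kappa>)"
        using sle \<kappa> by (simp add: ennreal_mult ennreal_of_nat_eq_real_of_nat)
      then have "(\<Sum>i<N. \<Sum>j<i. ln (2 / dist (z i) (z j))) \<le> real (N choose 2) * \<kappa>"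
        using \<kappa> by (subst (asm) ennreal_le_iff) auto
      then have "pair_energy (z ` {..<N}) \<le> 2 * (real (N choose 2) * \<kappa>)"
        using pair_energy_image[OF inj] by simp
      also have "2 * real (N choose 2) = real N * (real N - 1)"
        using N by (simp add: choose_two real_of_nat_div of_nat_diff)
      then have "2 * (real (N choose 2) * \<kappa>) = real N * ((real N - 1) * \<kappa>)" by simp
      finally have ub: "pair_energy (z ` {..<N}) \<le> real N * ((real N - 1) * \<kappa>)" .
      have "real N * ((real N - 1) * (ln 2 - ln l / n) + 2 * ln l - 2 * ln N) \<le> pair_energy (z ` {..<N})"
        by (rule pair_energy_ge_lemniscate[OF P l E]) (use z N inj in \<open>auto simp: card_image\<close>)
      with ub have "real N * ((real N - 1) * (ln 2 - ln l / n) + 2 * ln l - 2 * ln N) \<le> real N * ((real N - 1) * \<kappa>)"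
        by linarith
      then have "(real N - 1) * (ln 2 - ln l / n) + 2 * ln l - 2 * ln N \<le> (real N - 1) * \<kappa>"
        using N by simp
      then show ?thesis using N by (simp add: field_simps)
    qed
    have lim: "(\<lambda>N. ln 2 - ln l / n + (2 * ln l - 2 * ln (real N)) / (real N - 1)) \<longlonglongrightarrow> ln 2 - ln l / n"
      by real_asymp
    have "ln 2 - ln l / n \<le> \<kappa>"
      by (rule LIMSEQ_le_const2[OF lim]) (use bd in blast)
    then show ?thesis by (simp add: eq enn2ereal_ennreal \<kappa> flip: K_def)
  qed
qed

lemma log_capacity_lemniscate_le:
  fixes P :: "complex poly"
  assumes "degree P = n" "lead_coeff P = 1" "n \<ge> 1" "0 < l" "l \<le> 1"
    and "E \<subseteq> sphere 0 1" "\<And>z. z \<in> E \<Longrightarrow> cmod (poly P z) \<le> l"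
  shows "log_capacity E \<le> exp (ln l / n)"
  using log_capacity_le[of E "- ln l / n"] log_energy_ge_lemniscate[OF assms] by simp

section \<open>Extremal polynomials\<close>

lemma poly_sum_coeffs:
  assumes "degree p \<le> N"
  shows "poly p (t::'a::comm_ring_1) = coeff p N * t ^ N + (\<Sum>k<N. coeff p k * t ^ k)"
proof -
  have "poly p t = (\<Sum>k\<le>N. coeff p k * t ^ k)" 
    using assms by (subst poly_as_sum_of_monoms'[OF assms, symmetric]) (simp add: poly_sum poly_monom)
  then show ?thesis by (simp add: lessThan_Suc_atMost[symmetric])
qed

locale circle_prob =
  prob_space \<rho> for \<rho> :: "complex measure" +
  assumes sets_circle: "sets \<rho> = sets (restrict_space borel (sphere 0 1))"
begin

lemma space_circle: "space \<rho> = sphere 0 1"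
  using sets_eq_imp_space_eq[OF sets_circle] by (simp add: space_restrict_space)

lemma measurable_circle:
  "f \<in> borel_measurable borel \<Longrightarrow> f \<in> borel_measurable \<rho>"
  unfolding measurable_cong_sets[OF sets_circle refl] by (rule measurable_restrict_space1)

lemma integrable_circle:
  fixes f :: "complex \<Rightarrow> 'b::{banach, second_countable_topology}"
  assumes "continuous_on UNIV f"
  shows "integrable \<rho> f"
proof -
  have "compact (f ` sphere 0 1)"
    by (intro compact_continuous_image continuous_on_subset[OF assms]) auto
  then obtain B where B: "\<And>x. x \<in> sphere 0 1 \<Longrightarrow> norm (f x) \<le> B"
    by (meson bounded_iff compact_imp_bounded image_eqI)
  show ?thesis
    by (rule integrable_const_bound[of _ B])
      (use B space_circle assms in \<open>auto intro!: AE_I2 measurable_circle borel_measurable_continuous_onI\<close>)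
qed

text \<open>The \<open>L^2\<close> semi-inner product. It degenerates when \<open>\<rho>\<close> has
  finite support, where nonzero polynomials can vanish almost everywhere.\<close>

definition ip :: "complex poly \<Rightarrow> complex poly \<Rightarrow> complex" where
  "ip p q = (\<integral>t. poly p t * cnj (poly q t) \<partial>\<rho>)"

lemma integrable_ip: "integrable \<rho> (\<lambda>t. poly p t * cnj (poly q t))"
  by (intro integrable_circle continuous_intros)

lemma integrable_norm_poly: "integrable \<rho> (\<lambda>t. (cmod (poly p t))\<^sup>2)"
  by (intro integrable_circle continuous_intros)

lemma ip_add: "ip (p + q) r = ip p r + ip q r"
  by (simp add: ip_def distrib_right integrable_ip)

lemma ip_diff: "ip (p - q) r = ip p r - ip q r"
  by (simp add: ip_def left_diff_distrib integrable_ip)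

lemma ip_smult: "ip (smult c p) r = c * ip p r"
  by (simp add: ip_def mult.assoc)

lemma ip_sum: "ip (\<Sum>k\<in>A. f k) r = (\<Sum>k\<in>A. ip (f k) r)"
  by (induction A rule: infinite_finite_induct) (simp_all add: ip_add, simp_all add: ip_def)

lemma ip_cnj: "ip q p = cnj (ip p q)"
  unfolding ip_def by (simp add: mult.commute flip: Bochner_Integration.integral_cnj)

lemma ip_self: "ip p p = complex_of_real (\<integral>t. (cmod (poly p t))\<^sup>2 \<partial>\<rho>)"
  unfolding ip_def by (simp only: flip: integral_complex_of_real complex_norm_square)

text \<open>A polynomial of norm 0 vanishes almost everywhere; this settles the degenerate
  directions of the Gram-Schmidt process.\<close>

lemma ip_zero_of_self_zero:
  assumes "ip p p = 0" shows "ip q p = 0"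
proof -
  have "(\<integral>t. (cmod (poly p t))\<^sup>2 \<partial>\<rho>) = 0" using assms by (simp add: ip_self)
  then have "AE t in \<rho>. (cmod (poly p t))\<^sup>2 = 0"
    using integral_nonneg_eq_0_iff_AE[OF integrable_norm_poly] by simp
  then have "AE t in \<rho>. poly q t * cnj (poly p t) = 0" by eventually_elim simp
  then show ?thesis unfolding ip_def by (simp add: integral_eq_zero_AE)
qed

text \<open>The monic \<open>P k\<close> have every degree below \<open>n\<close>, so subtracting
  the multiple of \<open>P (degree q)\<close> with the same leading coefficient lowers the degree of
  \<open>q\<close>.\<close>

lemma ip_orthogonal_extend:
  assumes P: "\<And>k. k < n \<Longrightarrow> degree (P k) = k" "\<And>k. k < n \<Longrightarrow> lead_coeff (P k) = 1"
    and orth: "\<And>k. k < n \<Longrightarrow> ip r (P k) = 0" and "degree q < n"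
  shows "ip r q = 0"
  using assms(4)
proof (induction "degree q" arbitrary: q rule: less_induct)
  case less
  let ?k = "degree q"
  define q' where "q' = q - smult (lead_coeff q) (P ?k)"
  have q0: "ip r q = ip r q' + cnj (lead_coeff q) * ip r (P ?k)"
    by (subst (1 2 3) ip_cnj) (simp add: q'_def ip_diff ip_smult)
  have "ip r q' = 0"
  \<comment> \<open>A constant has no smaller degree to descend to; there the subtraction leaves
    0.\<close>
  proof (cases "?k = 0")
    case True
    then have "q' = 0" using P[of 0] less.prems by (auto simp: q'_def elim!: degree_eq_zeroE)
    then show ?thesis by (simp add: ip_def)
  next
    case False
    have "degree q' \<le> ?k" unfolding q'_def
      using P[of ?k] less.prems by (intro degree_diff_le order.trans[OF degree_smult_le]) auto
    moreover have "coeff q' ?k = 0" using P[of ?k] less.prems by (simp add: q'_def)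
    ultimately have "degree q' < ?k" using False
      by (metis degree_0 gr0I le_neq_implies_less leading_coeff_0_iff)
    then show ?thesis using less by simp
  qed
  then show ?case using q0 orth less.prems by simp
qed

text \<open>Gram-Schmidt applied to \<open>monom 1 n\<close>: only lower degrees are subtracted, so
  the result stays monic of degree \<open>n\<close>.\<close>

lemma ex_orthogonal_poly:
  "\<exists>P. degree P = n \<and> lead_coeff P = 1 \<and> (\<forall>q. degree q < n \<longrightarrow> ip P q = 0)"
proof (induction n rule: less_induct)
  case (less n)
  then obtain P where P: "\<And>k. k < n \<Longrightarrow> degree (P k) = k" "\<And>k. k < n \<Longrightarrow> lead_coeff (P k) = 1"
    and orth: "\<And>k q. k < n \<Longrightarrow> degree q < k \<Longrightarrow> ip (P k) q = 0" by metis
  have orth2: "ip (P k) (P j) = 0" if "k < n" "j < n" "k \<noteq> j" for k j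
    using that orth[of k "P j"] orth[of j "P k"] ip_cnj[of "P k" "P j"] P by (cases "j < k") auto
  \<comment> \<open>If \<open>P k\<close> has norm 0, the quotient is 0 by the convention for
    division. That is a correct coefficient, because \<open>ip_zero_of_self_zero\<close> makes the
    numerator vanish too.\<close>
  let ?c = "\<lambda>k. ip (monom 1 n) (P k) / ip (P k) (P k)"
  define S where "S = (\<Sum>k<n. smult (?c k) (P k))"
  define R where "R = monom 1 n - S"
  have "ip R (P j) = 0" if j: "j < n" for j
  proof -
    have "ip S (P j) = (\<Sum>k<n. if k = j then ?c j * ip (P j) (P j) else 0)"
      unfolding S_def ip_sum using j by (intro sum.cong) (auto simp: ip_smult orth2)
    then have "ip S (P j) = ?c j * ip (P j) (P j)" using j by simp
    also have "\<dots> = ip (monom 1 n) (P j)"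
      using ip_zero_of_self_zero[of "P j"] by auto
    finally show ?thesis by (simp add: R_def ip_diff)
  qed
  then have 1: "ip R q = 0" if "degree q < n" for q
    using that by (intro ip_orthogonal_extend[of n P R q] P) auto
  have cS: "coeff S k = 0" if "k \<ge> n" for k
    unfolding S_def using that P by (auto simp: coeff_sum coeff_eq_0 intro!: sum.neutral)
  have cR: "coeff R n = 1" using cS by (simp add: R_def)
  moreover have "degree R \<le> n" by (rule degree_le) (use cS in \<open>auto simp: R_def\<close>)
  moreover have "n \<le> degree R" using cR by (intro le_degree) simp
  ultimately have "degree R = n" "lead_coeff R = 1" by auto
  then show ?case using 1 by blast
qed

lemma poly_dist_le:
  assumes "degree Q = n" "lead_coeff Q = 1"
  shows "poly_dist \<rho> n \<le> sqrt (\<integral>t. (cmod (poly Q t))\<^sup>2 \<partial>\<rho>)"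
  unfolding poly_dist_def
proof (intro real_sqrt_le_mono cINF_lower2[where x = "coeff Q"])
  show "bdd_below (range (\<lambda>q. \<integral>t. (cmod (t ^ n + (\<Sum>k<n. q k * t ^ k)))\<^sup>2 \<partial>\<rho>))"
    by (rule bdd_belowI[of _ 0]) auto
  show "(\<integral>t. (cmod (t ^ n + (\<Sum>k<n. coeff Q k * t ^ k)))\<^sup>2 \<partial>\<rho>) \<le> (\<integral>t. (cmod (poly Q t))\<^sup>2 \<partial>\<rho>)"
    using assms by (simp add: poly_sum_coeffs[of Q n])
qed simp

text \<open>Pythagoras: every competitor is \<open>P + r\<close> with \<open>r\<close> zero or of
  degree below \<open>n\<close>, hence orthogonal to \<open>P\<close>, and its squared norm exceeds
  that of \<open>P\<close> by that of \<open>r\<close>.\<close>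

lemma poly_dist_attained:
  obtains P where "degree P = n" "lead_coeff P = 1"
    "(\<integral>t. (cmod (poly P t))\<^sup>2 \<partial>\<rho>) \<le> (poly_dist \<rho> n)\<^sup>2"
proof -
  obtain P where P: "degree P = n" "lead_coeff P = 1" and orth: "\<And>q. degree q < n \<Longrightarrow> ip P q = 0"
    using ex_orthogonal_poly by blast
  let ?I = "\<lambda>p. \<integral>t. (cmod (poly p t))\<^sup>2 \<partial>\<rho>"
  have min: "?I P \<le> (\<integral>t. (cmod (t ^ n + (\<Sum>k<n. q k * t ^ k)))\<^sup>2 \<partial>\<rho>)" for q
  proof -
    define Q where "Q = monom 1 n + (\<Sum>k<n. monom (q k) k)"
    have pQ: "poly Q t = t ^ n + (\<Sum>k<n. q k * t ^ k)" for t
      by (simp add: Q_def poly_monom poly_sum)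
    define r where "r = Q - P"
    have cr: "coeff r k = 0" if "k \<ge> n" for k
    proof -
      have "coeff Q k = (if k = n then 1 else 0)" using that by (auto simp: Q_def coeff_sum intro!: sum.neutral)
      then show ?thesis using P that by (auto simp: r_def coeff_eq_0)
    qed
    have r: "ip P r = 0"
    proof (cases "r = 0")
      case False
      then have "degree r < n" using cr leading_coeff_0_iff not_less by blast
      then show ?thesis by (rule orth)
    qed (simp add: ip_def)
    have "ip Q Q = ip (P + r) (P + r)" by (simp add: r_def)
    also have "\<dots> = ip P P + ip r r"
      using r ip_cnj[of P r] ip_cnj[of r "P + r"] ip_cnj[of P "P + r"] ip_cnj[of P P] ip_cnj[of r r]
      by (simp add: ip_add)
    finally have "?I Q = ?I P + ?I r" unfolding ip_self by (simp flip: of_real_add)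
    then have "?I P \<le> ?I Q" by simp
    then show ?thesis by (simp add: pQ)
  qed
  have "?I P \<le> (INF q. \<integral>t. (cmod (t ^ n + (\<Sum>k<n. q k * t ^ k)))\<^sup>2 \<partial>\<rho>)"
    by (rule cINF_greatest) (use min in auto)
  also have "\<dots> = (poly_dist \<rho> n)\<^sup>2"
    unfolding poly_dist_def by (subst real_sqrt_pow2) (auto intro: cINF_greatest)
  finally have "?I P \<le> (poly_dist \<rho> n)\<^sup>2" .
  with P show ?thesis by (rule that)
qed

end

section \<open>Sublevel sets of polynomials on the circle\<close>

lemma component_real_eq_interval:
  fixes F :: "real set"
  assumes "compact F" "C \<in> components F"
  obtains a b where "a \<le> b" "C = {a..b}"
proof -
  have "compact C" using assms by (metis compact_components)
  moreover have "is_interval C" "C \<noteq> {}"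
    using assms in_components_connected in_components_nonempty by (auto simp: is_interval_connected_1)
  ultimately obtain a b where "C = cbox a b" using is_interval_compact by metis
  then show ?thesis using \<open>C \<noteq> {}\<close> that[of a b] by auto
qed

text \<open>An interval inside \<open>F\<close> that meets two components would lie in both.\<close>

lemma components_separated:
  fixes F :: "real set"
  assumes "C \<in> components F" "D \<in> components F" "C \<noteq> D" "x \<in> C" "y \<in> D" "x < y"
  obtains s where "x < s" "s < y" "s \<notin> F"
proof (cases "{x..y} \<subseteq> F")
  case True
  have "{x..y} \<subseteq> C"
    by (rule components_maximal[OF assms(1) _ True]) (use assms in auto)
  moreover have "{x..y} \<subseteq> D"
    by (rule components_maximal[OF assms(2) _ True]) (use assms in auto)
  ultimately have "x \<in> C \<inter> D" using assms by fastforce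
  then show ?thesis using components_nonoverlap[OF assms(1,2)] assms(3) by blast
next
  case False
  then obtain s where "x \<le> s" "s \<le> y" "s \<notin> F" unfolding subset_eq by auto
  moreover have "x \<in> F" "y \<in> F" using assms in_components_subset by blast+
  ultimately show ?thesis using that[of s] by (metis order_le_less)
qed

lemma ex_zero_between:
  fixes g :: "real \<Rightarrow> real"
  assumes "continuous_on UNIV g" "x < y" "g x * g y < 0"
  shows "\<exists>z. x < z \<and> z < y \<and> g z = 0"
proof -
  have c: "continuous_on {x..y} g" using assms(1) continuous_on_subset by blast
  have "\<exists>z\<ge>x. z \<le> y \<and> g z = 0"
  proof (cases "g x < 0")
    case True
    then have "g y > 0" using assms(3) by (simp add: mult_less_0_iff)
    then show ?thesis using IVT'[of g x 0 y] c True assms(2) by fastforce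
  next
    case False
    then have "g x > 0" "g y < 0" using assms(3) by (auto simp: mult_less_0_iff)
    then show ?thesis using IVT2'[of g y 0 x] c assms(2) by fastforce
  qed
  then show ?thesis using assms(3) by (metis less_irrefl mult_zero_left mult_zero_right order_le_less)
qed

text \<open>Every point \<open>x\<close> of \<open>X\<close> lies between a nearest zero
  \<open>u x\<close> on its left and \<open>v x\<close> on its right. A positive value between two
  points of \<open>X\<close> has a zero on either side of it, so \<open>v x < u y\<close> for
  \<open>x < y\<close> and no zero is used twice.\<close>

lemma card_zeros_ge:
  fixes g :: "real \<Rightarrow> real"
  assumes g: "continuous_on UNIV g" and X: "finite X" "X \<subseteq> {a<..<b}" "\<And>x. x \<in> X \<Longrightarrow> g x < 0"
    and ab: "g a > 0" "g b > 0"
    and sep: "\<And>x y. x \<in> X \<Longrightarrow> y \<in> X \<Longrightarrow> x < y \<Longrightarrow> \<exists>s. x < s \<and> s < y \<and> g s > 0"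
    and fin: "finite {z\<in>{a<..<b}. g z = 0}"
  shows "2 * card X \<le> card {z\<in>{a<..<b}. g z = 0}"
proof -
  let ?Z = "{z\<in>{a<..<b}. g z = 0}"
  have fins: "finite {z\<in>?Z. z < x}" "finite {z\<in>?Z. x < z}" for x
    by (rule finite_subset[OF _ fin]; auto)+
  define u where "u x = Max {z\<in>?Z. z < x}" for x
  define v where "v x = Min {z\<in>?Z. x < z}" for x
  have zero: "\<exists>z. x < z \<and> z < y \<and> g z = 0" if "x < y" "g x * g y < 0" for x y
    using ex_zero_between[OF g that] .
  have u: "u x \<in> ?Z" "u x < x" if "x \<in> X" for x
  proof -
    have "a < x" "x < b" "g x < 0" using that X by auto
    then obtain z where "a < z" "z < x" "g z = 0" using zero[of a x] ab by (auto simp: mult_pos_neg)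
    with \<open>x < b\<close> have "{z\<in>?Z. z < x} \<noteq> {}" by auto
    then have "u x \<in> {z\<in>?Z. z < x}" unfolding u_def by (intro Max_in fins)
    then show "u x \<in> ?Z" "u x < x" by auto
  qed
  have v: "v x \<in> ?Z" "x < v x" if "x \<in> X" for x
  proof -
    have "a < x" "x < b" "g x < 0" using that X by auto
    then obtain z where "x < z" "z < b" "g z = 0" using zero[of x b] ab by (auto simp: mult_neg_pos)
    with \<open>a < x\<close> have "{z\<in>?Z. x < z} \<noteq> {}" by auto
    then have "v x \<in> {z\<in>?Z. x < z}" unfolding v_def by (intro Min_in fins)
    then show "v x \<in> ?Z" "x < v x" by auto
  qed
  have vu: "v x < u y" if xy: "x \<in> X" "y \<in> X" "x < y" for x y
  proof -
    obtain s where s: "x < s" "s < y" "g s > 0" using sep[OF xy] by auto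
    have "g x < 0" "g y < 0" "a < x" "y < b" using X xy by auto
    then obtain z w where zw: "x < z" "z < s" "g z = 0" "s < w" "w < y" "g w = 0"
      using zero[of x s] zero[of s y] s by (auto simp: mult_neg_pos mult_pos_neg)
    have "v x \<le> z" unfolding v_def by (intro Min_le fins) (use zw s \<open>a < x\<close> \<open>y < b\<close> in auto)
    moreover have "w \<le> u y" unfolding u_def by (intro Max_ge fins) (use zw s \<open>a < x\<close> \<open>y < b\<close> in auto)
    ultimately show ?thesis using zw by linarith
  qed
  have lt: "u x < u y" "v x < v y" if "x \<in> X" "y \<in> X" "x < y" for x y
    using vu[OF that] u(2)[of x] v(2)[of x] u(2)[of y] v(2)[of y] that by linarith+
  have iu: "inj_on u X" and iv: "inj_on v X"
    using lt by (auto simp: inj_on_def) (metis less_irrefl linorder_neqE_linordered_idom)+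
  have "u x \<noteq> v y" if "x \<in> X" "y \<in> X" for x y
    using vu[of x y] vu[of y x] u(2)[of x] v(2)[of x] u(2)[of y] v(2)[of y] that
    by (cases x y rule: linorder_cases) auto
  then have "u ` X \<inter> v ` X = {}" by auto
  then have "card (u ` X \<union> v ` X) = 2 * card X"
    using X by (simp add: card_Un_disjoint card_image iu iv)
  moreover have "card (u ` X \<union> v ` X) \<le> card ?Z"
    by (rule card_mono) (use fin u v in auto)
  ultimately show ?thesis by simp
qed

section \<open>Angular coordinates and trigonometric polynomials on the circle\<close>

lemma sphere_eq_cis: "sphere 0 1 = cis ` {a..a + 2 * pi}"
proof
  show "sphere 0 1 \<subseteq> cis ` {a..a + 2 * pi}"
  proof
    fix z :: complex assume "z \<in> sphere 0 1"
    then have "z / cis a = cis (Arg2pi (z / cis a))"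
      using Arg2pi_eq[of "z / cis a"] by (simp add: norm_divide cis_conv_exp)
    then have "z = cis (a + Arg2pi (z / cis a))"
      by (metis cis_mult cis_neq_zero nonzero_mult_div_cancel_left times_divide_eq_right)
    then show "z \<in> cis ` {a..a + 2 * pi}" 
      using Arg2pi_ge_0[of "z / cis a"] Arg2pi_lt_2pi[of "z / cis a"] by auto
  qed
qed auto

lemma inj_on_cis: "inj_on cis {a..<a + 2 * pi}"
proof (rule inj_onI)
  fix x y assume xy: "x \<in> {a..<a + 2 * pi}" "y \<in> {a..<a + 2 * pi}" "cis x = cis y"
  then obtain k :: int where k: "x = y + 2 * pi * k" 
    using sin_cos_eq_iff[of x y] by (auto simp: cis.code complex_eq_iff)
  then have "\<bar>2 * pi * k\<bar> < 2 * pi * 1" using xy by auto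
  then have "\<bar>real_of_int k\<bar> < 1" unfolding abs_mult by simp
  then show "x = y" using k by simp
qed

text \<open>On the circle \<open>cnj t = 1 / t\<close>, so the conjugate of \<open>P\<close> times
  \<open>t ^ n\<close> is the polynomial \<open>S\<close> with reversed, conjugated coefficients.
  Zeros of a trigonometric polynomial thus become roots of an algebraic one.\<close>

lemma ex_poly_norm_square:
  fixes P :: "complex poly"
  assumes "degree P = n"
  obtains R where "degree R \<le> 2 * n" "\<And>t. poly R (cis t) = (complex_of_real ((cmod (poly P (cis t)))\<^sup>2 - c)) * cis t ^ n"
proof
  define S where "S = (\<Sum>k\<le>n. monom (cnj (coeff P k)) (n - k))"
  define R where "R = P * S - monom (complex_of_real c) n"
  have dS: "degree S \<le> n" unfolding S_def
    by (intro degree_sum_le) (auto intro: order.trans[OF degree_monom_le])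
  have "degree (P * S) \<le> 2 * n" using degree_mult_le[of P S] dS assms by simp
  then show "degree R \<le> 2 * n" unfolding R_def
    by (intro degree_diff_le) (auto intro: order.trans[OF degree_monom_le])
  fix t
  have c: "cnj (cis t) * cis t = 1" by (simp add: cis_cnj cis_mult)
  have "cnj (poly P (cis t)) = (\<Sum>k\<le>n. cnj (coeff P k) * cnj (cis t) ^ k)"
    by (simp add: poly_altdef assms)
  then have "cnj (poly P (cis t)) * cis t ^ n = (\<Sum>k\<le>n. cnj (coeff P k) * (cnj (cis t) ^ k * cis t ^ n))"
    by (simp add: sum_distrib_right mult.assoc)
  also have "\<dots> = (\<Sum>k\<le>n. cnj (coeff P k) * cis t ^ (n - k))"
  proof (intro sum.cong refl)
    fix k assume "k \<in> {..n}"
    then have "cis t ^ n = cis t ^ k * cis t ^ (n - k)" by (simp flip: power_add)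
    then have "cnj (cis t) ^ k * cis t ^ n = (cnj (cis t) * cis t) ^ k * cis t ^ (n - k)"
      by (simp add: power_mult_distrib mult.assoc)
    then show "cnj (coeff P k) * (cnj (cis t) ^ k * cis t ^ n) = cnj (coeff P k) * cis t ^ (n - k)"
      unfolding c by simp
  qed
  also have "\<dots> = poly S (cis t)" by (simp add: S_def poly_sum poly_monom)
  finally have "poly S (cis t) = cnj (poly P (cis t)) * cis t ^ n" ..
  then show "poly R (cis t) = complex_of_real ((cmod (poly P (cis t)))\<^sup>2 - c) * cis t ^ n"
    by (simp add: R_def poly_monom algebra_simps complex_norm_square del: of_real_power)
qed

text \<open>One point from each of \<open>n + 1\<close> components would form a set that the
  assumption refutes, since points of different components are separated by a point outside
  \<open>F\<close>.\<close>

lemma card_components_le: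
  fixes F :: "real set"
  assumes "\<And>X. finite X \<Longrightarrow> X \<subseteq> F \<Longrightarrow> card X = Suc n \<Longrightarrow>
      (\<And>x y. x \<in> X \<Longrightarrow> y \<in> X \<Longrightarrow> x < y \<Longrightarrow> \<exists>s. x < s \<and> s < y \<and> s \<notin> F) \<Longrightarrow> False"
  shows "finite (components F) \<and> card (components F) \<le> n"
proof (rule ccontr)
  assume "\<not> ?thesis"
  then obtain T where T: "T \<subseteq> components F" "finite T" "card T = Suc n"
    by (metis infinite_arbitrarily_large obtain_subset_with_card_n not_less_eq_eq)
  define q where "q C = (SOME x. x \<in> C)" for C :: "real set"
  have q: "q C \<in> C" if "C \<in> T" for C
    using in_components_nonempty[of C F] that T unfolding q_def by (metis ex_in_conv someI subsetD)
  have inj: "inj_on q T"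
    by (rule inj_onI) (metis IntI T(1) components_nonoverlap empty_iff q subsetD)
  show False
  proof (rule assms)
    show "finite (q ` T)" "card (q ` T) = Suc n" using T inj by (auto simp: card_image)
    show "q ` T \<subseteq> F" using q T in_components_subset by blast
    fix x y assume "x \<in> q ` T" "y \<in> q ` T" "x < y"
    then obtain C D where "C \<in> T" "D \<in> T" "x = q C" "y = q D" "C \<noteq> D" by auto
    then show "\<exists>s. x < s \<and> s < y \<and> s \<notin> F"
      using components_separated[of C F D x y] q T \<open>x < y\<close> by (metis subsetD)
  qed
qed

text \<open>\<open>g\<close> is negative on \<open>X\<close> and positive at \<open>a\<close> and at
  the separating points, so it has at least \<open>2 * card X\<close> zeros in one period; these are
  roots of a nonzero polynomial of degree at most \<open>2 * n\<close>.\<close>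

lemma card_separated_le:
  fixes P :: "complex poly"
  assumes n: "degree P = n" and a: "cmod (poly P (cis a)) > r"
    and X: "finite X" "X \<subseteq> {a..a + 2 * pi}" "\<And>x. x \<in> X \<Longrightarrow> cmod (poly P (cis x)) \<le> r"
    and sep: "\<And>x y. x \<in> X \<Longrightarrow> y \<in> X \<Longrightarrow> x < y \<Longrightarrow> \<exists>s. x < s \<and> s < y \<and> cmod (poly P (cis s)) > r"
  shows "card X \<le> n"
proof (cases "X = {}")
  case False
  then obtain x0 where x0: "x0 \<in> X" by auto
  define h where "h t = cmod (poly P (cis t))" for t
  obtain s where s: "\<And>x y. x \<in> X \<Longrightarrow> y \<in> X \<Longrightarrow> x < y \<Longrightarrow> x < s x y \<and> s x y < y \<and> h (s x y) > r"
    using sep unfolding h_def by metis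
  have r0: "0 \<le> r" using X(3)[OF x0] by (rule order.trans[rotated]) simp
  \<comment> \<open>\<open>Y\<close> collects the finitely many values above \<open>r\<close> in
    play. A level \<open>r'\<close> strictly between \<open>r\<close> and all of them makes
    \<open>g\<close> strictly negative on \<open>X\<close>, even where the modulus is exactly
    \<open>r\<close>.\<close>
  define Y where "Y = insert (h a) ((\<lambda>(x, y). h (s x y)) ` {(x, y) \<in> X \<times> X. x < y})"
  have "finite {(x, y) \<in> X \<times> X. x < y}" by (rule finite_subset[of _ "X \<times> X"]) (use X in auto)
  then have Y: "finite Y" "Y \<noteq> {}" by (auto simp: Y_def)
  have "\<forall>y\<in>Y. r < y" using s a by (auto simp: Y_def h_def)
  then have "r < Min Y" using Y by simp
  then obtain r' where r': "r < r'" "r' < Min Y" using dense by blast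
  then have rY: "r' < y" if "y \<in> Y" for y using that Y by simp
  define g where "g t = (h t)\<^sup>2 - r'\<^sup>2" for t
  have gpos: "g t > 0" if "h t \<in> Y" for t
    using rY[OF that] r' r0 unfolding g_def by (simp add: power_strict_mono)
  have gneg: "g x < 0" if "x \<in> X" for x
    using X(3)[OF that] r' unfolding g_def h_def by (simp add: power_strict_mono)
  obtain R where R: "degree R \<le> 2 * n" "\<And>t. poly R (cis t) = complex_of_real (g t) * cis t ^ n"
    using ex_poly_norm_square[OF n, of "r'\<^sup>2"] unfolding g_def h_def by blast
  have "R \<noteq> 0" using R(2)[of x0] gneg[OF x0] by auto
  let ?Z = "{z\<in>{a<..<a + 2 * pi}. g z = 0}"
  have sub: "cis ` ?Z \<subseteq> {z. poly R z = 0}" using R(2) by auto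
  have injZ: "inj_on cis ?Z" by (rule inj_on_subset[OF inj_on_cis[of a]]) auto
  have finR: "finite {z. poly R z = 0}" using \<open>R \<noteq> 0\<close> by (rule poly_roots_finite)
  have finZ: "finite ?Z" using finite_subset[OF sub finR] injZ finite_imageD by blast
  have ha: "h (a + 2 * pi) = h a" unfolding h_def by (simp flip: cis_mult)
  have "2 * card X \<le> card ?Z"
  proof (rule card_zeros_ge[OF _ X(1) _ gneg _ _ _ finZ])
    show "continuous_on UNIV g" unfolding g_def h_def by (intro continuous_intros)
    show "g a > 0" "g (a + 2 * pi) > 0" using ha by (auto intro!: gpos simp: Y_def)
    show "X \<subseteq> {a<..<a + 2 * pi}"
    proof
      fix x assume x: "x \<in> X"
      then have "h x < h a" "h x < h (a + 2 * pi)" using X(3)[OF x] a ha by (auto simp: h_def)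
      then have "x \<noteq> a" "x \<noteq> a + 2 * pi" by auto
      then show "x \<in> {a<..<a + 2 * pi}" using X(2) x by fastforce
    qed
    fix x y assume "x \<in> X" "y \<in> X" "x < y"
    then show "\<exists>s. x < s \<and> s < y \<and> 0 < g s"
      using s by (intro exI[of _ "s x y"]) (auto intro!: gpos simp: Y_def)
  qed
  also have "\<dots> = card (cis ` ?Z)" using injZ by (simp add: card_image)
  also have "\<dots> \<le> card {z. poly R z = 0}" by (rule card_mono[OF finR sub])
  also have "\<dots> \<le> 2 * n" using card_poly_roots_bound[OF \<open>R \<noteq> 0\<close>] R(1) by linarith
  finally show ?thesis by simp
qed simp

text \<open>Cutting the circle at an angle \<open>a\<close> where the modulus exceeds
  \<open>r\<close> keeps every arc of the sublevel set inside one period, so the arcs are images of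
  the components of a compact set of reals. If no such angle exists, the whole circle is one arc,
  and \<open>n \<ge> 1\<close> allows it.\<close>

lemma sublevel_arcs:
  fixes P :: "complex poly"
  assumes n: "degree P = n" "n \<ge> 1"
  obtains p I where "p \<le> n" "\<And>l. l \<in> {1..p} \<Longrightarrow> closed_arc (I l)"
    "(\<Union>l\<in>{1..p}. I l) = {t \<in> sphere 0 1. cmod (poly P t) \<le> r}"
proof (cases "\<forall>t\<in>sphere 0 1. cmod (poly P t) \<le> r")
  case True
  have "closed_arc (sphere 0 1)" unfolding closed_arc_def
    by (rule exI[of _ 0], rule exI[of _ "2 * pi"]) (use sphere_eq_cis[of 0] in simp)
  then show ?thesis using True n by (intro that[of 1 "\<lambda>_. sphere 0 1"]) auto
next
  case False
  then obtain a where a: "cmod (poly P (cis a)) > r"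
    unfolding sphere_eq_cis[of 0] by (auto simp: not_le)
  define F where "F = {a..a + 2 * pi} \<inter> {t. cmod (poly P (cis t)) \<le> r}"
  have cF: "compact F" unfolding F_def
    by (intro compact_Int_closed closed_Collect_le continuous_intros) auto
  have "finite (components F) \<and> card (components F) \<le> n"
  proof (rule card_components_le)
    fix X assume X: "finite X" "X \<subseteq> F" "card X = Suc n"
      and sep: "\<And>x y. x \<in> X \<Longrightarrow> y \<in> X \<Longrightarrow> x < y \<Longrightarrow> \<exists>s. x < s \<and> s < y \<and> s \<notin> F"
    have "card X \<le> n"
    proof (rule card_separated_le[OF n(1) a X(1)])
      fix x y assume xy: "x \<in> X" "y \<in> X" "x < y"
      then obtain s where "x < s" "s < y" "s \<notin> F" using sep by blast
      moreover from xy have "x \<in> F" "y \<in> F" using X(2) by auto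
      ultimately show "\<exists>s. x < s \<and> s < y \<and> cmod (poly P (cis s)) > r"
        by (intro exI[of _ s]) (auto simp: F_def)
    qed (use X(2) in \<open>auto simp: F_def\<close>)
    then show False using X(3) by simp
  qed
  then have fin: "finite (components F)" and card: "card (components F) \<le> n" by auto
  obtain e where e: "bij_betw e {1..card (components F)} (components F)"
    using ex_bij_betw_nat_finite_1[OF fin] by blast
  show ?thesis
  proof (rule that[OF card, of "\<lambda>l. cis ` e l"])
    fix l assume "l \<in> {1..card (components F)}"
    then have el: "e l \<in> components F" using e by (auto simp: bij_betw_def)
    then obtain \<alpha> \<beta> where ab: "\<alpha> \<le> \<beta>" "e l = {\<alpha>..\<beta>}" using component_real_eq_interval[OF cF] by blast
    then have "\<alpha> \<in> F" "\<beta> \<in> F" using in_components_subset[OF el] by auto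
    then have "\<beta> \<le> \<alpha> + 2 * pi" by (simp add: F_def)
    then show "closed_arc (cis ` e l)" using ab unfolding closed_arc_def by blast
  next
    have "(\<Union>l\<in>{1..card (components F)}. e l) = F"
      using e Union_components[of F] by (simp add: bij_betw_def)
    then have "(\<Union>l\<in>{1..card (components F)}. cis ` e l) = cis ` F" by (simp flip: image_UN)
    also have "\<dots> = {t \<in> sphere 0 1. cmod (poly P t) \<le> r}"
      unfolding F_def sphere_eq_cis[of a] by auto
    finally show "(\<Union>l\<in>{1..card (components F)}. cis ` e l) = {t \<in> sphere 0 1. cmod (poly P t) \<le> r}" .
  qed
qed

section \<open>Part (A): arcs from the extremal polynomial\<close>

lemma log_capacity_empty: "log_capacity {} = 0"
  by (simp add: log_capacity_def robin_const_def top_ereal_def)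

lemma (in circle_prob) arcs_of_poly_dist_le:
  assumes n: "n \<ge> 1" and le: "poly_dist \<rho> n \<le> exp (- \<Omega>)"
  shows "\<exists>p\<le>n. \<exists>I::nat \<Rightarrow> complex set.
          (\<forall>l\<in>{1..p}. closed_arc (I l)) \<and>
          log_capacity (\<Union>l\<in>{1..p}. I l) \<le> exp (- (1/2) * (\<Omega> / real n)) \<and>
          measure \<rho> (sphere 0 1 - (\<Union>l\<in>{1..p}. I l)) \<le> exp (- \<Omega>)"
proof (cases "\<Omega> \<le> 0")
  case True
  \<comment> \<open>For \<open>\<Omega> \<le> 0\<close> the bound on the measure is at least 1, and
    no arcs at all will do.\<close>
  then have "measure \<rho> (sphere 0 1) \<le> exp (- \<Omega>)" by (intro order.trans[OF prob_le_1]) simp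
  then show ?thesis by (intro exI[of _ 0]) (auto simp: log_capacity_empty)
next
  case False
  obtain P where P: "degree P = n" "lead_coeff P = 1"
    and Ple: "(\<integral>t. (cmod (poly P t))\<^sup>2 \<partial>\<rho>) \<le> (poly_dist \<rho> n)\<^sup>2"
    by (rule poly_dist_attained)
  \<comment> \<open>The integral of \<open>\<bar>P\<bar>^2\<close> is at most
    \<open>exp (- 2 * \<Omega>)\<close>. Markov's inequality at level
    \<open>l^2 = exp (- \<Omega>)\<close> leaves measure at most \<open>exp (- \<Omega>)\<close>
    outside, and the lemniscate has capacity at most \<open>l\<close> to the power
    \<open>1 / n\<close>, the origin of the factor 1/2.\<close>
  define l where "l = exp (- \<Omega> / 2)"
  have l: "0 < l" "l \<le> 1" using False by (auto simp: l_def)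
  let ?E = "{t \<in> sphere 0 1. cmod (poly P t) \<le> l}"
  obtain p I where p: "p \<le> n" and I: "\<And>l. l \<in> {1..p} \<Longrightarrow> closed_arc (I l)"
    and U: "(\<Union>l\<in>{1..p}. I l) = ?E"
    using sublevel_arcs[OF P(1) n, of l] by blast
  have "log_capacity ?E \<le> exp (ln l / n)"
    by (rule log_capacity_lemniscate_le[OF P n l]) auto
  then have cap: "log_capacity ?E \<le> exp (- (1/2) * (\<Omega> / real n))" by (simp add: l_def field_simps)
  have "0 \<le> poly_dist \<rho> n" unfolding poly_dist_def by (auto intro: cINF_greatest)
  then have "(poly_dist \<rho> n)\<^sup>2 \<le> (exp (- \<Omega>))\<^sup>2" using le by (intro power_mono)
  also have "(exp (- \<Omega>))\<^sup>2 = exp (- \<Omega>) * l\<^sup>2" by (simp add: l_def power2_eq_square flip: exp_add)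
  finally have int: "(\<integral>t. (cmod (poly P t))\<^sup>2 \<partial>\<rho>) \<le> exp (- \<Omega>) * l\<^sup>2" using Ple by linarith
  have [measurable]: "(\<lambda>t. (cmod (poly P t))\<^sup>2) \<in> borel_measurable \<rho>"
    using integrable_norm_poly by blast
  have "measure \<rho> (sphere 0 1 - ?E) \<le> measure \<rho> {t \<in> space \<rho>. (cmod (poly P t))\<^sup>2 \<ge> l\<^sup>2}"
  proof (rule finite_measure_mono)
    show "sphere 0 1 - ?E \<subseteq> {t \<in> space \<rho>. l\<^sup>2 \<le> (cmod (poly P t))\<^sup>2}"
      using l by (auto simp: space_circle intro!: power_mono)
  qed measurable
  also have "\<dots> \<le> (\<integral>t. (cmod (poly P t))\<^sup>2 \<partial>\<rho>) / l\<^sup>2"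
    using l by (intro integral_Markov_inequality_measure[where A = "space \<rho>"] integrable_norm_poly) auto
  also have "\<dots> \<le> exp (- \<Omega>)" using int l by (simp add: divide_le_eq)
  finally show ?thesis using p I cap by (intro exI[of _ p] exI[of _ I] conjI) (auto simp only: U)
qed

section \<open>Kernel estimates on gaps\<close>

lemma dist_cis: "dist (cis x) (cis y) = 2 * \<bar>sin ((x - y) / 2)\<bar>"
proof -
  have "(dist (cis x) (cis y))\<^sup>2 = (cos x - cos y)\<^sup>2 + (sin x - sin y)\<^sup>2"
    by (simp add: dist_norm cmod_power2)
  also have "\<dots> = 2 - 2 * cos (x - y)"
    using sin_cos_squared_add[of x] sin_cos_squared_add[of y]
    by (simp add: cos_diff power2_eq_square algebra_simps)
  also have "x - y = 2 * ((x - y) / 2)" by simp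
  then have "2 - 2 * cos (x - y) = 2 - 2 * cos (2 * ((x - y) / 2))" by (rule arg_cong)
  also have "\<dots> = (2 * \<bar>sin ((x - y) / 2)\<bar>)\<^sup>2"
    unfolding cos_double_sin by (simp add: power_mult_distrib)
  finally show ?thesis by (rule power2_eq_imp_eq) auto
qed

lemma dist_cis_of_le: "x \<le> y \<Longrightarrow> y \<le> x + 2 * pi \<Longrightarrow> dist (cis x) (cis y) = 2 * sin ((y - x) / 2)"
  by (subst dist_commute) (simp add: dist_cis sin_ge_zero)

text \<open>Concavity of the sine on \<open>[0, pi]\<close>; the term with \<open>w\<close> is
  nonnegative and is dropped.\<close>

lemma sin_half_scale_le:
  assumes "0 \<le> v" "v \<le> 2 * pi" "0 \<le> w" "w \<le> 2 * pi" "0 \<le> k" "k \<le> 1"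
  shows "k * sin (v / 2) \<le> sin ((k * v + (1 - k) * w) / 2)"
proof -
  have "concave_on {0..pi} sin" unfolding concave_on_def
    by (rule f''_ge0_imp_convex[where f' = "\<lambda>x. - cos x" and f'' = sin])
      (auto intro!: derivative_eq_intros sin_ge_zero)
  then have "k * sin (v / 2) + (1 - k) * sin (w / 2) \<le> sin (k *\<^sub>R (v / 2) + (1 - k) *\<^sub>R (w / 2))"
    using assms concave_onD[of "{0..pi}" sin "1 - k" "v / 2" "w / 2"] by auto
  moreover have "0 \<le> (1 - k) * sin (w / 2)" using assms by (intro mult_nonneg_nonneg sin_ge_zero) auto
  ultimately show ?thesis by (simp add: add_divide_distrib)
qed

text \<open>The product is 0 at the origin, as is its limit there. This carries the antiderivative
  \<open>F\<close> below across the logarithmic singularity.\<close>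

lemma continuous_x_ln_abs: "continuous_on UNIV (\<lambda>x::real. x * ln \<bar>x\<bar>)"
proof (rule continuous_at_imp_continuous_on, intro ballI)
  fix x :: real
  show "isCont (\<lambda>x. x * ln \<bar>x\<bar>) x"
  proof (cases "x = 0")
    case True
    have "((\<lambda>x::real. x * ln \<bar>x\<bar>) \<longlongrightarrow> 0) (at 0)" by real_asymp
    then show ?thesis using True by (simp add: isCont_def)
  qed (intro continuous_intros, auto)
qed

text \<open>Fundamental theorem of calculus with the antiderivative \<open>F\<close>, which is
  continuous at the singularity \<open>t\<close>. The inequality \<open>ln y \<le> y - 1\<close>
  bounds each of the two boundary terms by \<open>b - a\<close>.\<close>

lemma nn_integral_ln_div_abs_le:
  fixes a b t :: real
  assumes "a < b" "a \<le> t" "t \<le> b"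
  shows "(\<integral>\<^sup>+s. ennreal (ln ((b - a) / \<bar>s - t\<bar>)) * indicator {a..b} s \<partial>lborel) \<le> ennreal (2 * (b - a))"
proof -
  define l where "l = b - a"
  have l: "l > 0" using assms by (simp add: l_def)
  define F where "F s = (s - t) - l * ((s - t) / l * ln \<bar>(s - t) / l\<bar>)" for s
  have hi: "((\<lambda>s. ln (l / \<bar>s - t\<bar>)) has_integral (F b - F a)) {a..b}"
  proof (rule fundamental_theorem_of_calculus_interior_strong[where S = "{t}"])
    show "continuous_on {a..b} F" unfolding F_def
      by (intro continuous_intros continuous_on_compose2[OF continuous_x_ln_abs]) (use l in auto)
    fix s assume s: "s \<in> {a<..<b} - {t}"
    have 1: "((\<lambda>s. ln \<bar>(s - t) / l\<bar>) has_real_derivative 1 / (s - t)) (at s)"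
    proof (cases "s > t")
      case True
      have "((\<lambda>s. ln ((s - t) / l)) has_real_derivative 1 / (s - t)) (at s)"
        using True l by (auto intro!: derivative_eq_intros simp: field_simps)
      then show ?thesis
        by (rule has_field_derivative_transform_within_open[of _ _ _ "{t<..}"]) (use True l in auto)
    next
      case False
      have "((\<lambda>s. ln ((t - s) / l)) has_real_derivative 1 / (s - t)) (at s)"
        using False s l by (auto intro!: derivative_eq_intros simp: field_simps)
      then show ?thesis
        by (rule has_field_derivative_transform_within_open[of _ _ _ "{..<t}"]) (use False s l in auto)
    qed
    have 2: "((\<lambda>s. s - t) has_real_derivative 1) (at s)" "((\<lambda>s. (s - t) / l) has_real_derivative 1 / l) (at s)"
      using l by (auto intro!: derivative_eq_intros)
    have "(F has_real_derivative 1 - l * (1 / l * ln \<bar>(s - t) / l\<bar> + 1 / (s - t) * ((s - t) / l))) (at s)"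
      unfolding F_def by (intro DERIV_diff DERIV_cmult DERIV_mult 1 2)
    also have "1 - l * (1 / l * ln \<bar>(s - t) / l\<bar> + 1 / (s - t) * ((s - t) / l)) = - ln \<bar>(s - t) / l\<bar>"
    proof -
      have *: "1 - l * (1 / l * L + 1 / x * (x / l)) = - L" if "x \<noteq> 0" for x L
        using that l by (simp add: field_simps)
      show ?thesis by (rule *) (use s in auto)
    qed
    finally have "(F has_real_derivative - ln \<bar>(s - t) / l\<bar>) (at s)" .
    moreover have "- ln \<bar>(s - t) / l\<bar> = ln (l / \<bar>s - t\<bar>)" using s l by (simp add: ln_div abs_divide)
    ultimately show "(F has_vector_derivative ln (l / \<bar>s - t\<bar>)) (at s)"
      by (simp add: has_real_derivative_iff_has_vector_derivative)
  qed (use assms in auto)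
  have nn: "0 \<le> ln (l / \<bar>s - t\<bar>)" if "s \<in> {a..b}" for s
  proof (cases "s = t")
    case False
    moreover have "\<bar>s - t\<bar> \<le> b - a" using that assms by auto
    ultimately show ?thesis by (simp add: l_def)
  qed simp
  have "(\<integral>\<^sup>+s. ennreal (ln ((b - a) / \<bar>s - t\<bar>)) * indicator {a..b} s \<partial>lborel)
     = (\<integral>\<^sup>+s. ennreal (indicator {a..b} s * max 0 (ln (l / \<bar>s - t\<bar>))) \<partial>lborel)"
    by (intro nn_integral_cong) (auto simp: l_def indicator_def split: split_max)
  also have "\<dots> = ennreal (F b - F a)"
  proof (rule nn_integral_has_integral_lebesgue)
    show "((\<lambda>s. max 0 (ln (l / \<bar>s - t\<bar>))) has_integral (F b - F a)) {a..b}"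
      by (rule has_integral_eq[OF _ hi]) (use nn in \<open>auto simp: max_def\<close>)
  qed auto
  also have "F b - F a \<le> 2 * (b - a)"
  proof -
    have x: "- (l * (x / l * ln (x / l))) \<le> l - x" if "x \<ge> 0" for x
    proof (cases "x = 0")
      case False
      have "x * ln (l / x) \<le> x * (l / x - 1)" using that False l by (intro mult_left_mono ln_le_minus_one) auto
      also have "x * (l / x - 1) = l - x" using False by (simp add: field_simps)
      also have "x * ln (l / x) = - (l * (x / l * ln (x / l)))"
        using that False l by (simp add: ln_div algebra_simps)
      finally show ?thesis .
    qed (use l in simp)
    have "F b \<le> (b - t) + (l - (b - t))" using x[of "b - t"] assms l by (simp add: F_def)
    moreover have "- F a \<le> (t - a) + (l - (t - a))"
      using x[of "t - a"] assms l by (simp add: F_def field_simps)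
    ultimately show ?thesis by (simp add: l_def)
  qed
  finally show ?thesis by (simp add: ennreal_leI)
qed

lemma ln_shift:
  fixes d x k :: real
  assumes "0 < d" "0 < x" "k * x \<le> d" "0 < k"
  shows "ln (2 / d) \<le> ln (2 / x) + ln (1 / k)"
proof -
  have "2 / d \<le> (2 / x) * (1 / k)" using assms by (simp add: divide_simps mult.commute)
  then have "ln (2 / d) \<le> ln ((2 / x) * (1 / k))" using assms by (intro ln_mono) auto
  also have "\<dots> = ln (2 / x) + ln (1 / k)" using assms by (intro ln_mult_pos) auto
  finally show ?thesis .
qed

text \<open>Move \<open>a\<close> to \<open>s\<close>, then \<open>c\<close> to \<open>t\<close>.
  With \<open>k\<close> the fraction of the first gap to the right of \<open>s\<close>,
  \<open>c - s\<close> is a convex combination of \<open>c - a\<close> and \<open>c - b\<close>, so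
  by concavity the chord shrinks at most by the factor \<open>k\<close>; likewise with
  \<open>m\<close> for \<open>t\<close>. Each factor costs an integrable logarithm, singular at the
  right end of its gap.\<close>

lemma kernel_le_distinct_gaps:
  assumes "a < b" "b \<le> c" "c < d" "d < a + 2 * pi"
    and s: "a \<le> s" "s < b" and t: "c \<le> t" "t < d"
  shows "ln (2 / dist (cis s) (cis t)) \<le> ln (2 / dist (cis a) (cis c)) + ln ((b - a) / \<bar>s - b\<bar>) + ln ((d - c) / \<bar>t - d\<bar>)"
    and "cis s \<noteq> cis t"
proof -
  define k where "k = (b - s) / (b - a)"
  define m where "m = (d - t) / (d - c)"
  have km: "0 < k" "k \<le> 1" "0 < m" "m \<le> 1" using assms by (auto simp: k_def m_def)
  have "k * (b - a) = b - s" "m * (d - c) = d - t" using assms by (auto simp: k_def m_def)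
  then have ek: "k * (c - a) + (1 - k) * (c - b) = c - s"
    and em: "m * (c - s) + (1 - m) * (d - s) = t - s"
    by (simp_all add: algebra_simps)
  have 1: "k * sin ((c - a) / 2) \<le> sin ((c - s) / 2)"
    using sin_half_scale_le[of "c - a" "c - b" k] km assms unfolding ek by simp
  have 2: "m * sin ((c - s) / 2) \<le> sin ((t - s) / 2)"
    using sin_half_scale_le[of "c - s" "d - s" m] km assms unfolding em by simp
  have p: "0 < sin ((c - a) / 2)" using assms by (intro sin_gt_zero) auto
  have "m * (k * sin ((c - a) / 2)) \<le> m * sin ((c - s) / 2)" using 1 km by simp
  with 2 have 3: "(k * m) * sin ((c - a) / 2) \<le> sin ((t - s) / 2)" by (simp add: mult_ac)
  then have p2: "0 < sin ((t - s) / 2)" using p km by (meson less_le_trans mult_pos_pos)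
  have d: "dist (cis s) (cis t) = 2 * sin ((t - s) / 2)" "dist (cis a) (cis c) = 2 * sin ((c - a) / 2)"
    using assms by (auto intro!: dist_cis_of_le)
  then show "cis s \<noteq> cis t" using p2 by auto
  have "ln (2 / dist (cis s) (cis t)) \<le> ln (2 / dist (cis a) (cis c)) + ln (1 / (k * m))"
    by (rule ln_shift) (use d p p2 3 km in auto)
  also have "1 / (k * m) = (1 / k) * (1 / m)" by simp
  also have "ln ((1 / k) * (1 / m)) = ln (1 / k) + ln (1 / m)" using km by (subst ln_mult_pos) auto
  also have "1 / k = (b - a) / \<bar>s - b\<bar>" using assms by (auto simp: k_def)
  also have "1 / m = (d - c) / \<bar>t - d\<bar>" using assms by (auto simp: m_def)
  finally show "ln (2 / dist (cis s) (cis t)) \<le> ln (2 / dist (cis a) (cis c)) + ln ((b - a) / \<bar>s - b\<bar>) + ln ((d - c) / \<bar>t - d\<bar>)" by simp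
qed

text \<open>Within one gap the comparison is with the chord of its two ends,
  \<open>\<bar>t - s\<bar>\<close> being a convex combination of \<open>b - a\<close> and 0.\<close>

lemma kernel_le_same_gap:
  assumes "a < b" "b < a + 2 * pi" and s: "a \<le> s" "s \<le> b" and t: "a \<le> t" "t \<le> b" and "s \<noteq> t"
  shows "ln (2 / dist (cis s) (cis t)) \<le> ln (2 / dist (cis a) (cis b)) + ln ((b - a) / \<bar>t - s\<bar>)"
    and "cis s \<noteq> cis t"
proof -
  define k where "k = \<bar>t - s\<bar> / (b - a)"
  have k: "0 < k" "k \<le> 1" "\<bar>t - s\<bar> = k * (b - a)" using assms by (auto simp: k_def)
  have "k * sin ((b - a) / 2) \<le> sin (\<bar>t - s\<bar> / 2)"
    using sin_half_scale_le[of "b - a" 0 k] k assms by simp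
  moreover have p: "0 < sin ((b - a) / 2)" using assms by (intro sin_gt_zero) auto
  ultimately have 1: "k * sin ((b - a) / 2) \<le> sin (\<bar>t - s\<bar> / 2)" "0 < sin (\<bar>t - s\<bar> / 2)"
    using k by (auto intro: less_le_trans[OF mult_pos_pos])
  have d: "dist (cis s) (cis t) = 2 * sin (\<bar>t - s\<bar> / 2)" "dist (cis a) (cis b) = 2 * sin ((b - a) / 2)"
    using assms dist_cis_of_le[of s t] dist_cis_of_le[of t s] dist_cis_of_le[of a b]
    by (auto simp: abs_if dist_commute)
  then show "cis s \<noteq> cis t" using 1(2) by auto
  have "ln (2 / dist (cis s) (cis t)) \<le> ln (2 / dist (cis a) (cis b)) + ln (1 / k)"
    by (rule ln_shift) (use d p 1 k in auto)
  also have "1 / k = (b - a) / \<bar>t - s\<bar>" by (simp add: k_def)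
  finally show "ln (2 / dist (cis s) (cis t)) \<le> ln (2 / dist (cis a) (cis b)) + ln ((b - a) / \<bar>t - s\<bar>)" .
qed

section \<open>Energy of a measure spread over gaps\<close>

lemma nn_integral_add_ln_le:
  fixes k :: ennreal
  assumes "a < b" "a \<le> p" "p \<le> b"
  shows "(\<integral>\<^sup>+t. (k + ennreal (ln ((b - a) / \<bar>t - p\<bar>))) * indicator {a..b} t \<partial>lborel) \<le> (k + 2) * ennreal (b - a)"
proof -
  have "(\<integral>\<^sup>+t. (k + ennreal (ln ((b - a) / \<bar>t - p\<bar>))) * indicator {a..b} t \<partial>lborel)
    = k * ennreal (b - a) + (\<integral>\<^sup>+t. ennreal (ln ((b - a) / \<bar>t - p\<bar>)) * indicator {a..b} t \<partial>lborel)"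
    using assms by (simp add: distrib_right nn_integral_add nn_integral_cmult_indicator)
  also have "\<dots> \<le> k * ennreal (b - a) + ennreal (2 * (b - a))"
    by (intro add_left_mono nn_integral_ln_div_abs_le assms)
  also have "ennreal (2 * (b - a)) = 2 * ennreal (b - a)" using assms by (subst ennreal_mult) auto
  also have "k * ennreal (b - a) + 2 * ennreal (b - a) = (k + 2) * ennreal (b - a)"
    by (simp add: distrib_right)
  finally show ?thesis .
qed

text \<open>Each of the two logarithms has mean at most 2 over its gap, which gives 4. The right
  ends, where \<open>f\<close> is not bounded by assumption, are null sets.\<close>

lemma nn_integral_distinct_gaps_le:
  fixes k :: ennreal and f :: "real \<Rightarrow> real \<Rightarrow> ennreal"
  assumes "a < b" "c < d"
    and f: "\<And>s t. a \<le> s \<Longrightarrow> s < b \<Longrightarrow> c \<le> t \<Longrightarrow> t < d \<Longrightarrow>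
      f s t \<le> k + ennreal (ln ((b - a) / \<bar>s - b\<bar>)) + ennreal (ln ((d - c) / \<bar>t - d\<bar>))"
  shows "(\<integral>\<^sup>+s. (\<integral>\<^sup>+t. f s t * indicator {c..d} t \<partial>lborel) * indicator {a..b} s \<partial>lborel)
     \<le> (k + 4) * (ennreal (b - a) * ennreal (d - c))"
proof -
  have inner: "(\<integral>\<^sup>+t. f s t * indicator {c..d} t \<partial>lborel) \<le> (k + 2 + ennreal (ln ((b - a) / \<bar>s - b\<bar>))) * ennreal (d - c)"
    if s: "a \<le> s" "s < b" for s
  proof -
    have "(\<integral>\<^sup>+t. f s t * indicator {c..d} t \<partial>lborel) \<le>
      (\<integral>\<^sup>+t. ((k + ennreal (ln ((b - a) / \<bar>s - b\<bar>))) + ennreal (ln ((d - c) / \<bar>t - d\<bar>))) * indicator {c..d} t \<partial>lborel)"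
    proof (rule nn_integral_mono_AE)
      show "AE t in lborel. f s t * indicator {c..d} t \<le>
        ((k + ennreal (ln ((b - a) / \<bar>s - b\<bar>))) + ennreal (ln ((d - c) / \<bar>t - d\<bar>))) * indicator {c..d} t"
        using AE_lborel_singleton[of d] by eventually_elim (use f[OF s] in \<open>auto simp: indicator_def\<close>)
    qed
    also have "\<dots> \<le> (k + ennreal (ln ((b - a) / \<bar>s - b\<bar>)) + 2) * ennreal (d - c)"
      by (rule nn_integral_add_ln_le) (use assms in auto)
    finally show ?thesis by (simp add: add_ac)
  qed
  have "(\<integral>\<^sup>+s. (\<integral>\<^sup>+t. f s t * indicator {c..d} t \<partial>lborel) * indicator {a..b} s \<partial>lborel)
    \<le> (\<integral>\<^sup>+s. (k + 2 + ennreal (ln ((b - a) / \<bar>s - b\<bar>))) * indicator {a..b} s * ennreal (d - c) \<partial>lborel)"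
  proof (rule nn_integral_mono_AE)
    show "AE s in lborel. (\<integral>\<^sup>+t. f s t * indicator {c..d} t \<partial>lborel) * indicator {a..b} s \<le>
        (k + 2 + ennreal (ln ((b - a) / \<bar>s - b\<bar>))) * indicator {a..b} s * ennreal (d - c)"
      using AE_lborel_singleton[of b] by eventually_elim (use inner in \<open>auto simp: indicator_def\<close>)
  qed
  also have "\<dots> = (\<integral>\<^sup>+s. (k + 2 + ennreal (ln ((b - a) / \<bar>s - b\<bar>))) * indicator {a..b} s \<partial>lborel) * ennreal (d - c)"
    by (rule nn_integral_multc) measurable
  also have "\<dots> \<le> (k + 2 + 2) * ennreal (b - a) * ennreal (d - c)"
    by (intro mult_right_mono nn_integral_add_ln_le) (use assms in auto)
  also have "k + 2 + 2 = k + 4" by (simp add: add.assoc)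
  finally show ?thesis by (simp add: mult.assoc)
qed

lemma nn_integral_same_gap_le:
  fixes k :: ennreal and f :: "real \<Rightarrow> real \<Rightarrow> ennreal"
  assumes "a < b"
    and f: "\<And>s t. a \<le> s \<Longrightarrow> s \<le> b \<Longrightarrow> a \<le> t \<Longrightarrow> t \<le> b \<Longrightarrow> t \<noteq> s \<Longrightarrow>
      f s t \<le> k + ennreal (ln ((b - a) / \<bar>t - s\<bar>))"
  shows "(\<integral>\<^sup>+s. (\<integral>\<^sup>+t. f s t * indicator {a..b} t \<partial>lborel) * indicator {a..b} s \<partial>lborel)
     \<le> (k + 4) * (ennreal (b - a) * ennreal (b - a))"
proof -
  have inner: "(\<integral>\<^sup>+t. f s t * indicator {a..b} t \<partial>lborel) \<le> (k + 4) * ennreal (b - a)"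
    if s: "a \<le> s" "s \<le> b" for s
  proof -
    have "(\<integral>\<^sup>+t. f s t * indicator {a..b} t \<partial>lborel) \<le>
      (\<integral>\<^sup>+t. (k + ennreal (ln ((b - a) / \<bar>t - s\<bar>))) * indicator {a..b} t \<partial>lborel)"
    proof (rule nn_integral_mono_AE)
      show "AE t in lborel. f s t * indicator {a..b} t \<le> (k + ennreal (ln ((b - a) / \<bar>t - s\<bar>))) * indicator {a..b} t"
        using AE_lborel_singleton[of s] by eventually_elim (use f[OF s] in \<open>auto simp: indicator_def\<close>)
    qed
    also have "\<dots> \<le> (k + 2) * ennreal (b - a)"
      by (rule nn_integral_add_ln_le) (use assms s in auto)
    \<comment> \<open>Weakened from 2 to 4 to share the form of the bound for distinct gaps.\<close>
    also have "\<dots> \<le> (k + 4) * ennreal (b - a)"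
      by (intro mult_right_mono add_left_mono) auto
    finally show ?thesis .
  qed
  have "(\<integral>\<^sup>+s. (\<integral>\<^sup>+t. f s t * indicator {a..b} t \<partial>lborel) * indicator {a..b} s \<partial>lborel)
    \<le> (\<integral>\<^sup>+s. (k + 4) * ennreal (b - a) * indicator {a..b} s \<partial>lborel)"
    by (rule nn_integral_mono) (use inner in \<open>auto simp: indicator_def\<close>)
  also have "\<dots> = (k + 4) * ennreal (b - a) * ennreal (b - a)"
    using assms by (simp add: nn_integral_cmult_indicator)
  finally show ?thesis by (simp add: mult.assoc)
qed

text \<open>Gap \<open>i\<close> runs from the angle \<open>\<theta> i\<close> to
  \<open>\<theta> (Suc i)\<close>. All gaps in \<open>G\<close> carry the same mass
  \<open>1 / card G\<close>, whatever their length, so each stands in for one point of the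
  configuration.\<close>

definition gap_measure :: "(nat \<Rightarrow> real) \<Rightarrow> nat set \<Rightarrow> complex measure" where
  "gap_measure \<theta> G = distr (density lborel (\<lambda>t. \<Sum>i\<in>G.
     ennreal (1 / (real (card G) * (\<theta> (Suc i) - \<theta> i))) * indicator {\<theta> i..\<theta> (Suc i)} t)) borel cis"

lemma measurable_cis [measurable]: "cis \<in> borel_measurable borel"
  by (intro borel_measurable_continuous_onI continuous_intros)

lemma sets_gap_measure [simp, measurable_cong]: "sets (gap_measure \<theta> G) = sets borel"
  by (simp add: gap_measure_def)

lemma nn_integral_gap_measure:
  assumes [measurable]: "f \<in> borel_measurable borel" and G: "finite G"
  shows "(\<integral>\<^sup>+z. f z \<partial>gap_measure \<theta> G) = (\<Sum>i\<in>G. ennreal (1 / (real (card G) * (\<theta> (Suc i) - \<theta> i))) *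
     (\<integral>\<^sup>+t. f (cis t) * indicator {\<theta> i..\<theta> (Suc i)} t \<partial>lborel))"
proof -
  have "(\<integral>\<^sup>+z. f z \<partial>gap_measure \<theta> G) = (\<integral>\<^sup>+t. (\<Sum>i\<in>G. ennreal (1 / (real (card G) * (\<theta> (Suc i) - \<theta> i))) *
     (f (cis t) * indicator {\<theta> i..\<theta> (Suc i)} t)) \<partial>lborel)"
    unfolding gap_measure_def
    by (subst nn_integral_distr, measurable, subst nn_integral_density, measurable)
      (auto simp: sum_distrib_left sum_distrib_right mult_ac intro!: nn_integral_cong sum.cong)
  also have "\<dots> = (\<Sum>i\<in>G. ennreal (1 / (real (card G) * (\<theta> (Suc i) - \<theta> i))) *
     (\<integral>\<^sup>+t. f (cis t) * indicator {\<theta> i..\<theta> (Suc i)} t \<partial>lborel))"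
    using G by (subst nn_integral_sum, measurable) (simp add: nn_integral_cmult)
  finally show ?thesis .
qed

lemma emeasure_gap_measure:
  assumes G: "finite G" "G \<noteq> {}" and \<theta>: "\<And>i. i \<in> G \<Longrightarrow> \<theta> i < \<theta> (Suc i)"
    and A: "A \<in> sets borel" "\<And>i. i \<in> G \<Longrightarrow> cis ` {\<theta> i..\<theta> (Suc i)} \<subseteq> A"
  shows "emeasure (gap_measure \<theta> G) A = 1"
proof -
  have M: "card G > 0" using G by (simp add: card_gt_0_iff)
  have "emeasure (gap_measure \<theta> G) A = (\<integral>\<^sup>+z. indicator A z \<partial>gap_measure \<theta> G)"
    using A by simp
  also have "\<dots> = (\<Sum>i\<in>G. ennreal (1 / (real (card G) * (\<theta> (Suc i) - \<theta> i))) *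
     (\<integral>\<^sup>+t. indicator A (cis t) * indicator {\<theta> i..\<theta> (Suc i)} t \<partial>lborel))"
    using A G by (intro nn_integral_gap_measure) auto
  also have "\<dots> = (\<Sum>i\<in>G. ennreal (1 / real (card G)))"
  proof (intro sum.cong refl)
    fix i assume i: "i \<in> G"
    have "(\<integral>\<^sup>+t. indicator A (cis t) * indicator {\<theta> i..\<theta> (Suc i)} t \<partial>lborel)
      = (\<integral>\<^sup>+t. indicator {\<theta> i..\<theta> (Suc i)} t \<partial>lborel)"
      using A(2)[OF i] by (intro nn_integral_cong) (auto simp: indicator_def)
    also have "\<dots> = ennreal (\<theta> (Suc i) - \<theta> i)" using \<theta>[OF i] by simp
    finally show "ennreal (1 / (real (card G) * (\<theta> (Suc i) - \<theta> i))) *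
     (\<integral>\<^sup>+t. indicator A (cis t) * indicator {\<theta> i..\<theta> (Suc i)} t \<partial>lborel) = ennreal (1 / real (card G))"
      using \<theta>[OF i] by (simp flip: ennreal_mult'')
  qed
  also have "\<dots> = 1" using M by (simp add: ennreal_of_nat_eq_real_of_nat flip: ennreal_mult)
  finally show ?thesis .
qed

lemma prob_space_gap_measure:
  assumes "finite G" "G \<noteq> {}" "\<And>i. i \<in> G \<Longrightarrow> \<theta> i < \<theta> (Suc i)"
  shows "prob_space (gap_measure \<theta> G)"
  by (rule prob_spaceI) (use emeasure_gap_measure[of G \<theta> UNIV] assms in \<open>simp add: gap_measure_def\<close>)

lemma shifted_kernel_cis_le:
  assumes "cis s \<noteq> cis t" "ln (2 / dist (cis s) (cis t)) \<le> c + x + y" "0 \<le> c" "0 \<le> x" "0 \<le> y"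
  shows "shifted_kernel (cis s) (cis t) \<le> ennreal c + ennreal x + ennreal y"
  using assms by (simp add: shifted_kernel_def ennreal_leI flip: ennreal_plus)

text \<open>Averaged over the gaps \<open>i\<close> and \<open>j\<close>, the shifted kernel is at
  most its value \<open>c i j\<close> at points of the configuration plus 4. The factor 2 pays for
  the diagonal of \<open>c\<close>.\<close>

lemma log_energy_gap_measure_le:
  assumes mono: "\<And>i j. i < j \<Longrightarrow> j < N \<Longrightarrow> \<theta> i < \<theta> j" and range: "\<And>i. i < N \<Longrightarrow> 0 \<le> \<theta> i \<and> \<theta> i < 2 * pi"
    and G: "G \<subseteq> {i. Suc i < N}" "G \<noteq> {}"
  shows "log_energy (gap_measure \<theta> G) \<le> ereal (4 + 2 * pair_energy ((\<lambda>i. cis (\<theta> i)) ` {..<N}) / (real (card G))\<^sup>2)"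
proof -
  let ?\<mu> = "gap_measure \<theta> G"
  let ?J = "\<lambda>i. {\<theta> i..\<theta> (Suc i)}"
  define z where "z i = cis (\<theta> i)" for i
  define l where "l i = \<theta> (Suc i) - \<theta> i" for i
  define M where "M = real (card G)"
  have finG: "finite G" using G(1) by (rule finite_subset) (auto intro: finite_subset[of _ "{..<N}"])
  have M: "M > 0" using finG G(2) by (simp add: M_def card_gt_0_iff)
  have GN: "Suc i < N" "i < N" if "i \<in> G" for i using G that by auto
  have lt: "\<theta> i < \<theta> (Suc i)" if "i \<in> G" for i using GN[OF that] mono by simp
  have l: "l i > 0" if "i \<in> G" for i using lt[OF that] by (simp add: l_def)
  have mono': "\<theta> i \<le> \<theta> j" if "i \<le> j" "j < N" for i j using mono[of i j] that by (cases "i = j") auto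
  \<comment> \<open>A point has infinite kernel with itself, so the diagonal entry takes the two
    ends of the gap instead.\<close>
  define c where "c i j = (if i = j then ln (2 / dist (z i) (z (Suc i))) else ln (2 / dist (z i) (z j)))" for i j
  have cnn: "0 \<le> c i j" for i j
    unfolding c_def by (auto simp: z_def intro!: ln_two_div_dist_nonneg)
  have pos: "0 \<le> ln (x / y)" if "0 \<le> y" "y \<le> x" for x y :: real
    using that by (cases "y = 0") auto
  have pairs: "(\<integral>\<^sup>+s. (\<integral>\<^sup>+t. shifted_kernel (cis s) (cis t) * indicator (?J j) t \<partial>lborel) * indicator (?J i) s \<partial>lborel)
      \<le> (ennreal (c i j) + 4) * (ennreal (l i) * ennreal (l j))" if ij: "i \<in> G" "j \<in> G" for i j
  proof -
    consider "i = j" | "i < j" | "j < i" by linarith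
    then show ?thesis
    proof cases
      case 1
      have "shifted_kernel (cis s) (cis t) \<le> ennreal (c i i) + ennreal (ln ((\<theta> (Suc i) - \<theta> i) / \<bar>t - s\<bar>))"
        if "\<theta> i \<le> s" "s \<le> \<theta> (Suc i)" "\<theta> i \<le> t" "t \<le> \<theta> (Suc i)" "t \<noteq> s" for s t
      proof -
        have "\<theta> (Suc i) < \<theta> i + 2 * pi" using range GN[OF ij(1)] by (smt (verit))
        then show ?thesis
          using kernel_le_same_gap[of "\<theta> i" "\<theta> (Suc i)" s t] that lt[OF ij(1)]
            shifted_kernel_cis_le[of s t "c i i" "ln ((\<theta> (Suc i) - \<theta> i) / \<bar>t - s\<bar>)" 0] cnn[of i i]
          by (simp add: c_def z_def pos)
      qed
      then show ?thesis unfolding 1 l_def using lt[OF ij(2)] by (intro nn_integral_same_gap_le) (auto simp: 1)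
    next
      case 2
      have "\<theta> (Suc i) \<le> \<theta> j" using 2 GN[OF ij(2)] by (intro mono') auto
      moreover have "\<theta> (Suc j) < \<theta> i + 2 * pi" using range[of i] range[of "Suc j"] GN[OF ij(1)] GN[OF ij(2)] by linarith
      ultimately have "shifted_kernel (cis s) (cis t) \<le> ennreal (c i j) + ennreal (ln ((\<theta> (Suc i) - \<theta> i) / \<bar>s - \<theta> (Suc i)\<bar>))
          + ennreal (ln ((\<theta> (Suc j) - \<theta> j) / \<bar>t - \<theta> (Suc j)\<bar>))"
        if "\<theta> i \<le> s" "s < \<theta> (Suc i)" "\<theta> j \<le> t" "t < \<theta> (Suc j)" for s t
        using kernel_le_distinct_gaps[of "\<theta> i" "\<theta> (Suc i)" "\<theta> j" "\<theta> (Suc j)" s t] that lt ij 2 cnn[of i j]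
        by (intro shifted_kernel_cis_le) (auto simp: c_def z_def intro!: pos)
      then show ?thesis unfolding l_def using lt ij by (intro nn_integral_distinct_gaps_le) auto
    next
      case 3
      have "\<theta> (Suc j) \<le> \<theta> i" using 3 GN[OF ij(1)] by (intro mono') auto
      moreover have "\<theta> (Suc i) < \<theta> j + 2 * pi" using range[of j] range[of "Suc i"] GN[OF ij(1)] GN[OF ij(2)] by linarith
      ultimately have "shifted_kernel (cis s) (cis t) \<le> ennreal (c i j) + ennreal (ln ((\<theta> (Suc i) - \<theta> i) / \<bar>s - \<theta> (Suc i)\<bar>))
          + ennreal (ln ((\<theta> (Suc j) - \<theta> j) / \<bar>t - \<theta> (Suc j)\<bar>))"
        if "\<theta> i \<le> s" "s < \<theta> (Suc i)" "\<theta> j \<le> t" "t < \<theta> (Suc j)" for s t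
        using kernel_le_distinct_gaps[of "\<theta> j" "\<theta> (Suc j)" "\<theta> i" "\<theta> (Suc i)" t s] that lt ij 3 cnn[of i j]
        by (intro shifted_kernel_cis_le) (auto simp: c_def z_def dist_commute intro!: pos)
      then show ?thesis unfolding l_def using lt ij by (intro nn_integral_distinct_gaps_le) auto
    qed
  qed
  have prob: "prob_space ?\<mu>" using finG G lt by (intro prob_space_gap_measure) auto
  have "emeasure ?\<mu> (sphere 0 1) = 1" using finG G lt by (intro emeasure_gap_measure) auto
  then have ae: "AE w in ?\<mu>. w \<in> sphere 0 1"
    using prob_space.AE_in_set_eq_1[OF prob, of "sphere 0 1"] by (simp add: measure_def)
  define e where "e i = ennreal (1 / (M * l i))" for i
  \<comment> \<open>Density times length is the mass of the gap, so the lengths cancel from the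
    final bound.\<close>
  have el: "e i * ennreal (l i) = ennreal (1 / M)" if "i \<in> G" for i
    unfolding e_def using l[OF that] M by (simp flip: ennreal_mult'')
  have "(\<integral>\<^sup>+z. \<integral>\<^sup>+w. shifted_kernel z w \<partial>?\<mu> \<partial>?\<mu>) =
     (\<Sum>i\<in>G. e i * (\<integral>\<^sup>+s. (\<Sum>j\<in>G. e j * (\<integral>\<^sup>+t. shifted_kernel (cis s) (cis t) * indicator (?J j) t \<partial>lborel)) * indicator (?J i) s \<partial>lborel))"
  proof -
    interpret \<mu>: prob_space ?\<mu> by fact
    have "(\<lambda>z. \<integral>\<^sup>+w. shifted_kernel z w \<partial>?\<mu>) \<in> borel_measurable borel"
      by (rule \<mu>.borel_measurable_nn_integral) measurable
    then show ?thesis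
      by (simp add: nn_integral_gap_measure finG e_def M_def l_def)
  qed
  also have "\<dots> = (\<Sum>i\<in>G. \<Sum>j\<in>G. e i * e j * (\<integral>\<^sup>+s. (\<integral>\<^sup>+t. shifted_kernel (cis s) (cis t) * indicator (?J j) t \<partial>lborel) * indicator (?J i) s \<partial>lborel))"
  proof (intro sum.cong refl)
    fix i
    let ?g = "\<lambda>j s. \<integral>\<^sup>+t. shifted_kernel (cis s) (cis t) * indicator (?J j) t \<partial>lborel"
    have [measurable]: "?g j \<in> borel_measurable borel" for j by measurable
    have "(\<integral>\<^sup>+s. (\<Sum>j\<in>G. e j * ?g j s) * indicator (?J i) s \<partial>lborel) = (\<integral>\<^sup>+s. (\<Sum>j\<in>G. e j * (?g j s * indicator (?J i) s)) \<partial>lborel)"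
      by (simp add: sum_distrib_right mult.assoc)
    also have "\<dots> = (\<Sum>j\<in>G. e j * (\<integral>\<^sup>+s. ?g j s * indicator (?J i) s \<partial>lborel))"
      by (subst nn_integral_sum, measurable) (simp add: nn_integral_cmult)
    finally show "e i * (\<integral>\<^sup>+s. (\<Sum>j\<in>G. e j * ?g j s) * indicator (?J i) s \<partial>lborel) =
        (\<Sum>j\<in>G. e i * e j * (\<integral>\<^sup>+s. ?g j s * indicator (?J i) s \<partial>lborel))"
      by (simp add: sum_distrib_left mult.assoc)
  qed
  also have "\<dots> \<le> (\<Sum>i\<in>G. \<Sum>j\<in>G. e i * e j * ((ennreal (c i j) + 4) * (ennreal (l i) * ennreal (l j))))"
    by (intro sum_mono mult_left_mono pairs) auto
  also have "\<dots> = (\<Sum>i\<in>G. \<Sum>j\<in>G. ennreal ((c i j + 4) / M\<^sup>2))"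
  proof (intro sum.cong refl)
    fix i j assume ij: "i \<in> G" "j \<in> G"
    have "e i * e j * ((ennreal (c i j) + 4) * (ennreal (l i) * ennreal (l j)))
       = (ennreal (c i j) + 4) * ((e i * ennreal (l i)) * (e j * ennreal (l j)))" by (simp add: mult_ac)
    also have "\<dots> = ennreal (c i j + 4) * (ennreal (1 / M) * ennreal (1 / M))"
      using cnn[of i j] by (simp add: el ij)
    also have "\<dots> = ennreal ((c i j + 4) / M\<^sup>2)"
      using M cnn[of i j] ennreal_mult[of "c i j + 4" "1 / M\<^sup>2"] ennreal_mult[of "1 / M" "1 / M"]
      by (simp add: power2_eq_square del: ennreal_plus)
    finally show "e i * e j * ((ennreal (c i j) + 4) * (ennreal (l i) * ennreal (l j))) = ennreal ((c i j + 4) / M\<^sup>2)" .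
  qed
  also have "\<dots> = ennreal (\<Sum>i\<in>G. \<Sum>j\<in>G. (c i j + 4) / M\<^sup>2)"
    using cnn by (simp add: sum_nonneg)
  also have "(\<Sum>i\<in>G. \<Sum>j\<in>G. (c i j + 4) / M\<^sup>2) = (\<Sum>i\<in>G. \<Sum>j\<in>G. c i j) / M\<^sup>2 + 4"
    using M by (simp add: sum_divide_distrib sum.distrib add_divide_distrib M_def power2_eq_square)
  also have "\<dots> \<le> 2 * pair_energy (z ` {..<N}) / M\<^sup>2 + 4"
  proof -
    have inj: "inj_on z {..<N}"
    proof (rule inj_onI)
      fix i j assume ij: "i \<in> {..<N}" "j \<in> {..<N}" "z i = z j"
      then have "\<theta> i = \<theta> j"
        using inj_onD[OF inj_on_cis[of 0], of "\<theta> i" "\<theta> j"] range by (simp add: z_def)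
      then show "i = j" using mono ij by (metis lessThan_iff less_irrefl linorder_neqE_nat)
    qed
    have pe: "pair_energy (z ` {..<N}) = (\<Sum>i<N. \<Sum>j\<in>{..<N}-{i}. ln (2 / dist (z i) (z j)))"
    proof -
      have "z ` {..<N} - {z i} = z ` ({..<N} - {i})" if "i < N" for i
        using inj that by (simp add: inj_on_image_set_diff[of z "{..<N}"])
      then show ?thesis unfolding pair_energy_def
        using inj by (simp add: sum.reindex inj_on_diff)
    qed
    have nn: "0 \<le> ln (2 / dist (z i) (z j))" for i j
      by (rule ln_two_div_dist_nonneg) (auto simp: z_def)
    \<comment> \<open>The diagonal entry \<open>c i i\<close> equals the term of the neighbour
      \<open>Suc i\<close> in the same row, so it at most doubles the row sum.\<close>
    have row: "(\<Sum>j\<in>G. c i j) \<le> 2 * (\<Sum>j\<in>{..<N}-{i}. ln (2 / dist (z i) (z j)))" if "i \<in> G" for i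
    proof -
      have "(\<Sum>j\<in>G. c i j) = c i i + (\<Sum>j\<in>G-{i}. c i j)" using finG that by (simp add: sum.remove)
      moreover have "c i i \<le> (\<Sum>j\<in>{..<N}-{i}. ln (2 / dist (z i) (z j)))"
        using GN[OF that] nn by (simp add: c_def) (rule member_le_sum, auto)
      moreover have "(\<Sum>j\<in>G-{i}. c i j) = (\<Sum>j\<in>G-{i}. ln (2 / dist (z i) (z j)))"
        by (intro sum.cong) (auto simp: c_def)
      moreover have "\<dots> \<le> (\<Sum>j\<in>{..<N}-{i}. ln (2 / dist (z i) (z j)))"
        using GN nn by (intro sum_mono2) auto
      ultimately show ?thesis by linarith
    qed
    have "(\<Sum>i\<in>G. \<Sum>j\<in>G. c i j) \<le> (\<Sum>i\<in>G. 2 * (\<Sum>j\<in>{..<N}-{i}. ln (2 / dist (z i) (z j))))"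
      by (intro sum_mono row)
    also have "\<dots> \<le> (\<Sum>i<N. 2 * (\<Sum>j\<in>{..<N}-{i}. ln (2 / dist (z i) (z j))))"
      using GN nn by (intro sum_mono2) (auto intro!: sum_nonneg)
    also have "\<dots> = 2 * pair_energy (z ` {..<N})" by (simp add: pe sum_distrib_left)
    finally show ?thesis by (intro add_right_mono divide_right_mono) auto
  qed
  finally have K: "(\<integral>\<^sup>+z. \<integral>\<^sup>+w. shifted_kernel z w \<partial>?\<mu> \<partial>?\<mu>) \<le> ennreal (2 * pair_energy (z ` {..<N}) / M\<^sup>2 + 4)"
    by (simp add: ennreal_leI)
  have "0 \<le> pair_energy (z ` {..<N})" unfolding pair_energy_def
    by (intro sum_nonneg ln_two_div_dist_nonneg) (auto simp: z_def)
  then have "enn2ereal (\<integral>\<^sup>+z. \<integral>\<^sup>+w. shifted_kernel z w \<partial>?\<mu> \<partial>?\<mu>) \<le> ereal (2 * pair_energy (z ` {..<N}) / M\<^sup>2 + 4)"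
    using K enn2ereal_ennreal[of "2 * pair_energy (z ` {..<N}) / M\<^sup>2 + 4"]
    by (simp only: less_eq_ennreal.rep_eq) simp
  \<comment> \<open>The term \<open>- ln 2\<close> of \<open>log_energy_eq\<close> is discarded
    here.\<close>
  then have "log_energy ?\<mu> \<le> ereal (2 * pair_energy (z ` {..<N}) / M\<^sup>2 + 4)"
    unfolding log_energy_eq[OF prob sets_gap_measure ae]
    by (rule order.trans[rotated]) (cases "enn2ereal (\<integral>\<^sup>+z. \<integral>\<^sup>+w. shifted_kernel z w \<partial>?\<mu> \<partial>?\<mu>)", auto)
  then show ?thesis by (simp add: z_def M_def add.commute)
qed

section \<open>Points of small pair energy on arcs\<close>

text \<open>Greedy choice: at each new point the product of distances to the \<open>N\<close>
  earlier ones exceeds \<open>\<eta>\<close>, so it adds at most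
  \<open>2 * (N * ln 2 - ln \<eta>)\<close> to the pair energy.\<close>

lemma ex_points_of_prod_dist_gt:
  assumes "\<eta> > 0"
    and "\<And>A. finite A \<Longrightarrow> A \<subseteq> E \<Longrightarrow> card A < N \<Longrightarrow> \<exists>z\<in>E. \<eta> < (\<Prod>w\<in>A. dist z w)"
  shows "\<exists>A. finite A \<and> A \<subseteq> E \<and> card A = N \<and> pair_energy A \<le> real N * (real N - 1) * ln 2 - 2 * real N * ln \<eta>"
  using assms(2)
proof (induction N)
  case 0
  then show ?case by (intro exI[of _ "{}"]) (simp add: pair_energy_def)
next
  case (Suc N)
  then obtain A where A: "finite A" "A \<subseteq> E" "card A = N"
    and pe: "pair_energy A \<le> real N * (real N - 1) * ln 2 - 2 * real N * ln \<eta>"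
    by (metis less_Suc_eq)
  then obtain z where z: "z \<in> E" "\<eta> < (\<Prod>w\<in>A. dist z w)" using Suc.prems[of A] by auto
  have "z \<notin> A"
  proof
    assume "z \<in> A"
    then have "(\<Prod>w\<in>A. dist z w) = 0" using A(1) by (intro prod_zero) auto
    then show False using z(2) assms(1) by simp
  qed
  have "ln \<eta> \<le> ln (\<Prod>w\<in>A. dist z w)" using z(2) assms(1) by (intro ln_mono) auto
  then have "(\<Sum>w\<in>A. ln (2 / dist z w)) \<le> real N * ln 2 - ln \<eta>"
    using sum_ln_two_div_dist[OF A(1) \<open>z \<notin> A\<close>] A(3) by simp
  then have "pair_energy (insert z A) \<le> real (Suc N) * (real (Suc N) - 1) * ln 2 - 2 * real (Suc N) * ln \<eta>"
    using pair_energy_insert[OF A(1) \<open>z \<notin> A\<close>] pe by (simp add: algebra_simps)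
  then show ?case using A z \<open>z \<notin> A\<close> by (intro exI[of _ "insert z A"]) auto
qed

lemma ex_sorted_angles:
  assumes "finite A" "A \<subseteq> sphere 0 1" "card A = N"
  obtains \<theta> :: "nat \<Rightarrow> real" where "\<And>i j. i < j \<Longrightarrow> j < N \<Longrightarrow> \<theta> i < \<theta> j"
    "\<And>i. i < N \<Longrightarrow> 0 \<le> \<theta> i \<and> \<theta> i < 2 * pi" "(\<lambda>i. cis (\<theta> i)) ` {..<N} = A"
proof -
  let ?T = "Arg2pi ` A"
  define xs where "xs = sorted_list_of_set ?T"
  have cis: "cis (Arg2pi z) = z" if "z \<in> A" for z
    using Arg2pi_eq[of z] assms(2) that by (auto simp: cis_conv_exp)
  then have "inj_on Arg2pi A" by (metis inj_onI)
  then have len: "length xs = N" using assms by (simp add: xs_def card_image)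
  have set: "set xs = ?T" using assms by (simp add: xs_def)
  then have im: "(\<lambda>i. xs ! i) ` {..<N} = ?T" using len by (auto simp: set_conv_nth)
  show ?thesis
  proof (rule that[of "\<lambda>i. xs ! i"])
    show "xs ! i < xs ! j" if "i < j" "j < N" for i j
      using that len sorted_wrt_nth_less[of "(<)" xs] strict_sorted_list_of_set[of ?T] by (auto simp: xs_def)
    show "0 \<le> xs ! i \<and> xs ! i < 2 * pi" if "i < N" for i
      using im that Arg2pi_ge_0 Arg2pi_lt_2pi by (metis (no_types, lifting) imageE imageI lessThan_iff)
    have "(\<lambda>i. cis (xs ! i)) ` {..<N} = cis ` ?T" unfolding im[symmetric] by (simp add: image_image)
    also have "\<dots> = A" using cis by (force simp: image_image)
    finally show "(\<lambda>i. cis (xs ! i)) ` {..<N} = A" .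
  qed
qed

section \<open>Gaps contained in a union of arcs\<close>

lemma cis_eq_cisE:
  assumes "cis x = cis y" obtains k :: int where "x = y + 2 * pi * k"
  using assms sin_cos_eq_iff[of x y] by (auto simp: complex_eq_iff)

text \<open>The arc contains one of the two circular arcs joining the points with angles \<open>x\<close> and \<open>y\<close>,
  hence the gap at the start of that circular arc.\<close>

lemma closed_arc_contains_gap:
  assumes "closed_arc I" "cis x \<in> I" "cis y \<in> I" "x < x'" "x' \<le> y" "y < y'" "y' < x + 2 * pi"
  shows "cis ` {x..x'} \<subseteq> I \<or> cis ` {y..y'} \<subseteq> I"
proof -
  obtain a b where I: "I = cis ` {a..b}" using assms(1) by (auto simp: closed_arc_def)
  obtain u v where u: "u \<in> {a..b}" "cis u = cis x" and v: "v \<in> {a..b}" "cis v = cis y"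
    using assms(2,3) unfolding I by (metis imageE)
  obtain k where k: "u = x + 2 * pi * of_int k" by (rule cis_eq_cisE[OF u(2)])
  obtain m where m: "v = y + 2 * pi * of_int m" by (rule cis_eq_cisE[OF v(2)])
  have per: "cis (s + 2 * pi * of_int j) = cis s" for s and j :: int
    by (simp add: cis_multiple_2pi flip: cis_mult)
  have shift: "cis ` {s..s'} \<subseteq> I" if "a \<le> s + 2 * pi * of_int j" "s' + 2 * pi * of_int j \<le> b" for s s' and j :: int
  proof
    fix w assume "w \<in> cis ` {s..s'}"
    then obtain r where r: "r \<in> {s..s'}" "w = cis r" by auto
    then have "r + 2 * pi * of_int j \<in> {a..b}" using that by auto
    then show "w \<in> I" unfolding I using r per by (metis imageI)
  qed
  show ?thesis
  \<comment> \<open>\<open>u\<close> and \<open>v\<close> are representatives in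
    \<open>{a..b}\<close>, shifted by \<open>k\<close> and \<open>m\<close> turns. If
    \<open>k \<le> m\<close>, the arc runs from \<open>x\<close> on to \<open>y\<close> at least and
    covers \<open>{x..x'}\<close>; otherwise it runs from \<open>y\<close> on to \<open>x\<close> at
    least one turn later and covers \<open>{y..y'}\<close>.\<close>
  proof (cases "k \<le> m")
    case True
    then have "2 * pi * real_of_int k \<le> 2 * pi * real_of_int m" by simp
    moreover have "v \<le> b" using v by simp
    ultimately have "x' + 2 * pi * of_int k \<le> b" using m assms(5,6) by linarith
    then show ?thesis using shift[of x k x'] u k by auto
  next
    case False
    then have "2 * pi * real_of_int (m + 1) \<le> 2 * pi * real_of_int k" by (intro mult_left_mono) auto
    moreover have "u \<le> b" using u by simp
    ultimately have "y' + 2 * pi * of_int m \<le> b" using k assms(7) by (simp add: distrib_left)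
    then show ?thesis using shift[of y m y'] v m by auto
  qed
qed

text \<open>Assign to each point an arc \<open>l i\<close> containing it. By
  \<open>closed_arc_contains_gap\<close>, two gaps that the union does not cover cannot start in the
  same arc, so at most \<open>p\<close> of the \<open>N - 1\<close> gaps are lost. The gap from the
  last point round to the first is left out, whence the 1.\<close>

lemma card_gaps_ge:
  assumes mono: "\<And>i j. i < j \<Longrightarrow> j < N \<Longrightarrow> \<theta> i < \<theta> j" and range: "\<And>i. i < N \<Longrightarrow> 0 \<le> \<theta> i \<and> \<theta> i < 2 * pi"
    and arcs: "\<And>l. l \<in> {1..p} \<Longrightarrow> closed_arc (I l)" and pts: "\<And>i. i < N \<Longrightarrow> cis (\<theta> i) \<in> (\<Union>l\<in>{1..p}. I l)"
  shows "N \<le> card {i. Suc i < N \<and> cis ` {\<theta> i..\<theta> (Suc i)} \<subseteq> (\<Union>l\<in>{1..p}. I l)} + p + 1"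
proof -
  let ?E = "\<Union>l\<in>{1..p}. I l"
  let ?G = "{i. Suc i < N \<and> cis ` {\<theta> i..\<theta> (Suc i)} \<subseteq> ?E}"
  let ?B = "{i. Suc i < N \<and> \<not> cis ` {\<theta> i..\<theta> (Suc i)} \<subseteq> ?E}"
  have "\<forall>i. \<exists>k. i < N \<longrightarrow> k \<in> {1..p} \<and> cis (\<theta> i) \<in> I k" using pts by blast
  from choice[OF this] obtain l where l: "\<And>i. i < N \<Longrightarrow> l i \<in> {1..p} \<and> cis (\<theta> i) \<in> I (l i)" by blast
  have ne: "l i \<noteq> l j" if "i < j" "i \<in> ?B" "j \<in> ?B" for i j
  proof
    assume eq: "l i = l j"
    have N: "Suc i < N" "Suc j < N" using that by auto
    have "cis ` {\<theta> i..\<theta> (Suc i)} \<subseteq> I (l i) \<or> cis ` {\<theta> j..\<theta> (Suc j)} \<subseteq> I (l i)"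
    proof (rule closed_arc_contains_gap)
      show "closed_arc (I (l i))" "cis (\<theta> i) \<in> I (l i)" "cis (\<theta> j) \<in> I (l i)"
        using l[of i] l[of j] arcs N eq by auto
      show "\<theta> i < \<theta> (Suc i)" "\<theta> j < \<theta> (Suc j)" using mono N by auto
      show "\<theta> (Suc i) \<le> \<theta> j" using mono[of "Suc i" j] N \<open>i < j\<close> by (cases "Suc i = j") auto
      show "\<theta> (Suc j) < \<theta> i + 2 * pi" using range[of i] range[of "Suc j"] N by linarith
    qed
    moreover have "I (l i) \<subseteq> ?E" using l[of i] N by auto
    moreover have "\<not> cis ` {\<theta> i..\<theta> (Suc i)} \<subseteq> ?E" "\<not> cis ` {\<theta> j..\<theta> (Suc j)} \<subseteq> ?E" using that by simp_all
    ultimately show False by (meson order.trans)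
  qed
  have inj: "inj_on l ?B"
  proof (rule inj_onI)
    fix i j assume "i \<in> ?B" "j \<in> ?B" "l i = l j"
    then show "i = j" using ne[of i j] ne[of j i] by (cases i j rule: linorder_cases) simp_all
  qed
  have "l ` ?B \<subseteq> {1..p}"
  proof
    fix k assume "k \<in> l ` ?B"
    then obtain i where "k = l i" "Suc i < N" by blast
    then show "k \<in> {1..p}" using l[of i] by simp
  qed
  from card_inj_on_le[OF inj this] have B: "card ?B \<le> p" by simp
  have "{i. Suc i < N} = {..<N - 1}" by auto
  then have "N - 1 = card {i. Suc i < N}" by simp
  also have "{i. Suc i < N} = ?G \<union> ?B" by blast
  also have "card (?G \<union> ?B) \<le> card ?G + card ?B" by (rule card_Un_le)
  finally have "N - 1 \<le> card ?G + p" using B by linarith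
  then show ?thesis by linarith
qed

section \<open>Part (B): a small polynomial from arcs of small capacity\<close>

lemma compact_closed_arc: "closed_arc I \<Longrightarrow> compact I"
  unfolding closed_arc_def by (auto intro!: compact_continuous_image continuous_intros)

lemma borel_UN_closed_arc:
  assumes "\<And>l. l \<in> {1..p::nat} \<Longrightarrow> closed_arc (I l)"
  shows "(\<Union>l\<in>{1..p}. I l) \<in> sets borel"
  using assms compact_closed_arc by (intro borel_compact compact_UN) auto

lemma closed_arc_subset: "closed_arc I \<Longrightarrow> I \<subseteq> sphere 0 1"
  unfolding closed_arc_def by auto

text \<open>Otherwise the greedy construction yields \<open>6 * n\<close> points of small pair
  energy, and mass spread over their gaps inside the arcs has less energy than the capacity
  permits.\<close>

lemma ex_small_product:
  assumes n: "n \<ge> 1" and p: "p \<le> n" and arcs: "\<And>l. l \<in> {1..p} \<Longrightarrow> closed_arc (I l)"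
    and cap: "log_capacity (\<Union>l\<in>{1..p}. I l) \<le> exp (- (\<Omega> / real n))" and \<Omega>: "\<Omega> \<ge> 40 * real n"
  shows "\<exists>A. finite A \<and> A \<subseteq> (\<Union>l\<in>{1..p}. I l) \<and> card A < 6 * n \<and>
    (\<forall>z\<in>(\<Union>l\<in>{1..p}. I l). (\<Prod>w\<in>A. dist z w) \<le> exp (- \<Omega> / 2))"
proof (rule ccontr)
  let ?E = "\<Union>l\<in>{1..p}. I l"
  let ?N = "6 * n"
  assume neg: "\<not> ?thesis"
  have Esub: "?E \<subseteq> sphere 0 1" using arcs closed_arc_subset by blast
  have Eb: "?E \<in> sets borel" using arcs by (rule borel_UN_closed_arc)
  have "\<exists>A. finite A \<and> A \<subseteq> ?E \<and> card A = ?N \<and>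
      pair_energy A \<le> real ?N * (real ?N - 1) * ln 2 - 2 * real ?N * ln (exp (- \<Omega> / 2))"
  proof (rule ex_points_of_prod_dist_gt)
    fix A assume "finite A" "A \<subseteq> ?E" "card A < 6 * n"
    with neg show "\<exists>z\<in>?E. exp (- \<Omega> / 2) < (\<Prod>w\<in>A. dist z w)" by (metis not_le)
  qed simp
  then obtain A where A: "finite A" "A \<subseteq> ?E" "card A = ?N"
    and "pair_energy A \<le> real ?N * (real ?N - 1) * ln 2 - 2 * real ?N * ln (exp (- \<Omega> / 2))" by blast
  then have pe: "pair_energy A \<le> real ?N * (real ?N - 1) * ln 2 + real ?N * \<Omega>" by (simp add: mult_ac)
  have "A \<subseteq> sphere 0 1" using A Esub by blast
  then obtain \<theta> where mono: "\<And>i j. i < j \<Longrightarrow> j < ?N \<Longrightarrow> \<theta> i < \<theta> j"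
    and range: "\<And>i. i < ?N \<Longrightarrow> 0 \<le> \<theta> i \<and> \<theta> i < 2 * pi" and im: "(\<lambda>i. cis (\<theta> i)) ` {..<?N} = A"
    using ex_sorted_angles[of A ?N] A by blast
  define G where "G = {i. Suc i < ?N \<and> cis ` {\<theta> i..\<theta> (Suc i)} \<subseteq> ?E}"
  have "?N \<le> card G + p + 1" unfolding G_def
    by (rule card_gaps_ge[OF mono range arcs]) (use im A in auto)
  \<comment> \<open>The number of lost gaps is at most \<open>p + 1 \<le> 2 * n\<close>.\<close>
  then have M: "4 * n \<le> card G" using p n by linarith
  have Gsub: "G \<subseteq> {i. Suc i < ?N}" by (auto simp: G_def)
  have Gne: "G \<noteq> {}" using M n by auto
  have finG: "finite G" using M n by (metis card.infinite le_zero_eq mult_is_0 not_one_le_zero zero_neq_numeral)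
  have lt: "\<theta> i < \<theta> (Suc i)" if "i \<in> G" for i using that mono by (auto simp: G_def)
  have prob: "prob_space (gap_measure \<theta> G)" by (rule prob_space_gap_measure) (use finG Gne lt in auto)
  have em: "emeasure (gap_measure \<theta> G) ?E = 1"
    by (rule emeasure_gap_measure) (use finG Gne lt Eb in \<open>auto simp: G_def\<close>)
  have "\<Omega> / n > 0" using \<Omega> n by (simp add: divide_simps)
  have "ereal (\<Omega> / n) \<le> log_energy (gap_measure \<theta> G)"
    by (rule log_energy_ge_of_log_capacity_le[OF cap \<open>\<Omega> / n > 0\<close> prob _ em]) simp
  also have "\<dots> \<le> ereal (4 + 2 * pair_energy A / (real (card G))\<^sup>2)"
    using log_energy_gap_measure_le[of ?N \<theta>, OF mono range Gsub Gne] unfolding im .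
  finally have "\<Omega> / n \<le> 4 + 2 * pair_energy A / (real (card G))\<^sup>2" by simp
  also have "\<dots> \<le> 4 + 2 * (36 * (real n)\<^sup>2 + 6 * n * \<Omega>) / (16 * (real n)\<^sup>2)"
  proof -
    have "real ?N * (real ?N - 1) * ln 2 \<le> real ?N * real ?N * 1"
      using n ln_2_less_1 by (intro mult_mono) auto
    also have "real ?N * real ?N * 1 = 36 * (real n)\<^sup>2" by (simp add: power2_eq_square)
    finally have "pair_energy A \<le> 36 * (real n)\<^sup>2 + real ?N * \<Omega>" using pe by linarith
    then have "pair_energy A \<le> 36 * (real n)\<^sup>2 + 6 * n * \<Omega>" by simp
    moreover have "(16 * (real n)\<^sup>2) \<le> (real (card G))\<^sup>2"
      using power_mono[of "4 * real n" "real (card G)" 2] M by (simp add: power_mult_distrib)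
    moreover have "0 \<le> \<Omega>" using \<Omega> n by (meson mult_nonneg_nonneg of_nat_0_le_iff order_trans zero_le_numeral)
    ultimately show ?thesis using n by (intro add_left_mono frac_le) auto
  qed
  \<comment> \<open>The coefficient \<open>2 * 6 / 4^2 = 0.75\<close> has to be below 1. With
    \<open>C * n\<close> points it would be \<open>2 * C / (C - 2)^2\<close>, and 6 is the first
    integer \<open>C > 2\<close> that works. The threshold 40 exceeds
    \<open>8.5 / 0.25 = 34\<close>.\<close>
  also have "\<dots> = 8.5 + 0.75 * (\<Omega> / n)" using n by (simp add: field_simps power2_eq_square)
  finally have "\<Omega> / n \<le> 34" by simp
  moreover have "\<Omega> / n \<ge> 40" using \<Omega> n by (simp add: field_simps)
  ultimately show False by simp
qed

text \<open>The monic polynomial \<open>Q\<close> built on the zeros \<open>A\<close> is small on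
  the arcs, and off them it is at most \<open>2 ^ (6 * n)\<close> on a set of measure at most
  \<open>exp (- \<Omega>)\<close>.\<close>

lemma (in circle_prob) poly_dist_le_of_arcs:
  assumes n: "n \<ge> 1" and p: "p \<le> n" and arcs: "\<And>l. l \<in> {1..p} \<Longrightarrow> closed_arc (I l)"
    and cap: "log_capacity (\<Union>l\<in>{1..p}. I l) \<le> exp (- (\<Omega> / real n))"
    and out: "measure \<rho> (sphere 0 1 - (\<Union>l\<in>{1..p}. I l)) \<le> exp (- \<Omega>)"
    and \<Omega>: "\<Omega> \<ge> 40 * real n"
  shows "poly_dist \<rho> (6 * n) \<le> exp (- \<Omega> / 4)"
proof -
  let ?E = "\<Union>l\<in>{1..p}. I l"
  let ?N = "6 * n"
  obtain A where A: "finite A" "A \<subseteq> ?E" "card A < ?N"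
    and small: "\<And>z. z \<in> ?E \<Longrightarrow> (\<Prod>w\<in>A. dist z w) \<le> exp (- \<Omega> / 2)"
    using ex_small_product[OF n p arcs cap \<Omega>] by blast
  have Esub: "?E \<subseteq> sphere 0 1" using arcs closed_arc_subset by blast
  have Eb: "?E \<in> sets borel" using arcs by (rule borel_UN_closed_arc)
  have Em: "sphere 0 1 - ?E \<in> sets \<rho>"
    unfolding sets_circle sets_restrict_space
    by (rule image_eqI[of _ _ "- ?E"]) (blast, use Eb in \<open>rule borel_comp\<close>)
  \<comment> \<open>The power of \<open>t\<close> raises the degree to exactly \<open>6 * n\<close>
    without changing the modulus on the circle.\<close>
  define Q where "Q = monom (1::complex) (?N - card A) * (\<Prod>w\<in>A. [:-w, 1:])"
  have lead: "lead_coeff Q = 1" unfolding Q_def lead_coeff_mult lead_coeff_prod lead_coeff_monom by simp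
  have "degree Q = (?N - card A) + card A" unfolding Q_def
    using A(1) by (subst degree_mult_eq) (auto simp: degree_monom_eq monom_eq_0_iff degree_prod_eq_sum_degree)
  then have deg: "degree Q = ?N" using A(3) by simp
  have Q: "cmod (poly Q t) = (\<Prod>w\<in>A. dist t w)" if "t \<in> sphere 0 1" for t
  proof -
    have "cmod (\<Prod>w\<in>A. t - w) = (\<Prod>w\<in>A. dist t w)" unfolding dist_norm by (rule prod_norm[symmetric])
    then show ?thesis using that by (simp add: Q_def poly_monom poly_prod norm_mult norm_power)
  qed
  have Q2: "(cmod (poly Q t))\<^sup>2 \<le> exp (- \<Omega>)" if "t \<in> ?E" for t
  proof -
    have "(cmod (poly Q t))\<^sup>2 \<le> (exp (- \<Omega> / 2))\<^sup>2"
      using small[OF that] Q that Esub by (intro power_mono) auto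
    then show ?thesis by (simp add: power2_eq_square flip: exp_add)
  qed
  have Q4: "(cmod (poly Q t))\<^sup>2 \<le> 4 ^ ?N" if t: "t \<in> sphere 0 1" for t
  proof -
    have "(\<Prod>w\<in>A. dist t w) \<le> (\<Prod>w\<in>A. 2)"
      by (intro prod_mono conjI dist_sphere_le t subsetD[OF order.trans[OF A(2) Esub]]) auto
    also have "\<dots> \<le> 2 ^ ?N" using A(3) by (simp add: power_increasing)
    finally have "(cmod (poly Q t))\<^sup>2 \<le> (2 ^ ?N)\<^sup>2" using Q[OF t] by (intro power_mono) (auto intro: prod_nonneg)
    then show ?thesis by (simp add: power2_eq_square flip: power_mult_distrib)
  qed
  have "(\<integral>t. (cmod (poly Q t))\<^sup>2 \<partial>\<rho>) \<le> (\<integral>t. exp (- \<Omega>) + 4 ^ ?N * indicator (sphere 0 1 - ?E) t \<partial>\<rho>)"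
  proof (rule integral_mono)
    show "integrable \<rho> (\<lambda>t. exp (- \<Omega>) + 4 ^ ?N * indicator (sphere 0 1 - ?E) t)"
      using Em by (intro Bochner_Integration.integrable_add integrable_mult_right) (auto simp: emeasure_eq_measure)
    fix t assume "t \<in> space \<rho>"
    then have "t \<in> sphere 0 1" by (simp add: space_circle)
    then show "(cmod (poly Q t))\<^sup>2 \<le> exp (- \<Omega>) + 4 ^ ?N * indicator (sphere 0 1 - ?E) t"
      using Q2[of t] Q4[of t] exp_ge_zero[of "- \<Omega>"] by (cases "t \<in> ?E") (simp_all add: add_increasing)
  qed (rule integrable_norm_poly)
  also have "\<dots> = exp (- \<Omega>) + 4 ^ ?N * measure \<rho> (sphere 0 1 - ?E)"
    using Em by (simp add: emeasure_eq_measure prob_space)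
  also have "\<dots> \<le> exp (- \<Omega>) + 4 ^ ?N * exp (- \<Omega>)"
    by (intro add_left_mono mult_left_mono out) auto
  \<comment> \<open>Half of the exponent absorbs \<open>1 + 4 ^ (6 * n)\<close>, which is at most
    \<open>exp (20 * n)\<close>; hence the assumption \<open>\<Omega> \<ge> 40 * n\<close>. The
    square root halves what remains, leaving \<open>\<Omega> / 4\<close>.\<close>
  also have "\<dots> \<le> exp (\<Omega> / 2) * exp (- \<Omega>)"
  proof -
    have "(1::real) + 4 ^ ?N \<le> 2 * 4 ^ ?N" by simp
    also have "\<dots> \<le> 4 * 4 ^ ?N" by simp
    also have "\<dots> = 4 ^ (?N + 1)" by simp
    also have "\<dots> \<le> 4 ^ (10 * n)" using n by (intro power_increasing) auto
    also have "\<dots> \<le> exp 2 ^ (10 * n)"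
    proof (rule power_mono)
      have "(2::real) ^ 2 \<le> exp 1 ^ 2" using exp_ge_add_one_self[of 1] by (intro power_mono) auto
      then show "(4::real) \<le> exp 2" by (simp add: power2_eq_square flip: exp_add)
    qed simp
    also have "\<dots> = exp (20 * real n)" by (simp flip: exp_of_nat_mult)
    also have "\<dots> \<le> exp (\<Omega> / 2)" using \<Omega> by simp
    finally have "(1 + 4 ^ ?N) * exp (- \<Omega>) \<le> exp (\<Omega> / 2) * exp (- \<Omega>)" by (intro mult_right_mono) auto
    then show ?thesis by (simp add: distrib_right)
  qed
  also have "\<dots> = (exp (- \<Omega> / 4))\<^sup>2" by (simp add: power2_eq_square flip: exp_add)
  finally have "sqrt (\<integral>t. (cmod (poly Q t))\<^sup>2 \<partial>\<rho>) \<le> exp (- \<Omega> / 4)"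
    by (intro real_le_lsqrt) auto
  then show ?thesis using poly_dist_le[OF deg lead] by linarith
qed

theorem theorem9:
  "\<exists>(C\<^sub>1::real) (C::nat). C\<^sub>1 > 0 \<and> C > 0 \<and>
    (\<forall>(\<rho>::complex measure) (n::nat) (\<Omega>::real).
      prob_space \<rho> \<and> sets \<rho> = sets (restrict_space borel (sphere 0 1)) \<and> n \<ge> 2 \<longrightarrow>
      (poly_dist \<rho> n \<le> exp (- \<Omega>) \<longrightarrow>
        (\<exists>p\<le>n. \<exists>I::nat \<Rightarrow> complex set.
          (\<forall>l\<in>{1..p}. closed_arc (I l)) \<and>
          log_capacity (\<Union>l\<in>{1..p}. I l) \<le> exp (- (1/2) * (\<Omega> / real n)) \<and>
          measure \<rho> (sphere 0 1 - (\<Union>l\<in>{1..p}. I l)) \<le> exp (- \<Omega>))) \<and>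
      ((\<exists>p\<le>n. \<exists>I::nat \<Rightarrow> complex set.
          (\<forall>l\<in>{1..p}. closed_arc (I l)) \<and>
          log_capacity (\<Union>l\<in>{1..p}. I l) \<le> exp (- (\<Omega> / real n)) \<and>
          measure \<rho> (sphere 0 1 - (\<Union>l\<in>{1..p}. I l)) \<le> exp (- \<Omega>)) \<and>
        \<Omega> \<ge> C\<^sub>1 * real n \<longrightarrow>
        poly_dist \<rho> (C * n) \<le> exp (- \<Omega> / 4)))"
\<comment> \<open>The constant 40 serves both the contradiction in \<open>ex_small_product\<close>
  and the absorption in \<open>poly_dist_le_of_arcs\<close>; 6 is the number of greedy points per
  unit of \<open>n\<close>.\<close>
proof (rule exI[of _ 40], rule exI[of _ 6], intro conjI allI impI)
  fix \<rho> :: "complex measure" and n :: nat and \<Omega> :: real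
  assume h: "prob_space \<rho> \<and> sets \<rho> = sets (restrict_space borel (sphere 0 1)) \<and> n \<ge> 2"
  then interpret circle_prob \<rho> by (auto simp: circle_prob_def circle_prob_axioms_def)
  from h have n: "n \<ge> 1" by simp
  { assume "poly_dist \<rho> n \<le> exp (- \<Omega>)"
    then show "\<exists>p\<le>n. \<exists>I::nat \<Rightarrow> complex set.
          (\<forall>l\<in>{1..p}. closed_arc (I l)) \<and>
          log_capacity (\<Union>l\<in>{1..p}. I l) \<le> exp (- (1/2) * (\<Omega> / real n)) \<and>
          measure \<rho> (sphere 0 1 - (\<Union>l\<in>{1..p}. I l)) \<le> exp (- \<Omega>)"
      by (rule arcs_of_poly_dist_le[OF n]) }
  { assume "(\<exists>p\<le>n. \<exists>I::nat \<Rightarrow> complex set.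
          (\<forall>l\<in>{1..p}. closed_arc (I l)) \<and>
          log_capacity (\<Union>l\<in>{1..p}. I l) \<le> exp (- (\<Omega> / real n)) \<and>
          measure \<rho> (sphere 0 1 - (\<Union>l\<in>{1..p}. I l)) \<le> exp (- \<Omega>)) \<and> \<Omega> \<ge> 40 * real n"
    then show "poly_dist \<rho> (6 * n) \<le> exp (- \<Omega> / 4)"
      using poly_dist_le_of_arcs[OF n] by blast }
qed auto

end
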